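(* Let $X=(X_t)_{t\ge0}$ be a symmetric jump-paring Lévy process in $\mathbb{R}^d$ (see context), with Lévy density $\nu$. Suppose that - there exists $C_{15}>0$ such that for all $r\ge1$, $\nu(x-y)\le C_{15}\,\nu(x)$ whenever $|y|\le r$ and $|x|\ge2r$; and - $\sup_{s\ge1}\big[K_3^X(s)\,\Psi(1/s)\,s^d\big]<\infty$. Then for every $\eta>0$ and $r>0$ there exist constants $C_{16}>0$ and $R>0$, depending on $X$, $\eta$ and $r$, such that for every bounded non-negative function $f$ which is $(X,\eta)$-harmonic in $\overline B(0,r)^c$, $$f(x)\le C_{16}\,\|f\|_\infty\,\nu(x),\qquad|x|\ge R.$$
   Context: Process. $X=(X_t)_{t\ge0}$ is a symmetric Lévy process with values in $\mathbb{R}^d$, $d\ge1$; $\mathbf{P}^x,\mathbf{E}^x$ are the law and expectation for the process started at $x$. It is determined by $\mathbf{E}^0[e^{i\xi\cdot X_t}]=e^{-t\psi(\xi)}$ with $\psi(\xi)=A\xi\cdot\xi+\int(1-\cos(\xi\cdot z))\,\nu(dz)$, where $A$ is a symmetric non-negative definite matrix and $\nu$ is a symmetric Lévy measure. Standing assumption: $\nu(\mathbb{R}^d\setminus\{0\})=\infty$ and $\nu(dx)=\nu(x)dx$ with $\nu(x)>0$ (the density is also denoted $\nu$). Then $X_t$ has transition densities $p(t,x)$, $\mathbf{P}^0(X_t\in E)=\int_Ep(t,x)dx$. $\Psi(r)=\sup_{|\xi|\le r}\psi(\xi)$, $r>0$. $B(x,r)$ is the open ball, $\overline B(x,r)$ the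 closed ball, $\tau_D=\inf\{t\ge0:X_t\notin D\}$. For bounded open $D$ and $x,y\in D$, $p_D(t,x,y)=p(t,y-x)-\mathbf{E}^x[\tau_D<t;\,p(t-\tau_D,y-X_{\tau_D})]$ and $G_D(x,y)=\int_0^\infty p_D(t,x,y)dt$; $G_D(x,y)=0$ if $x\notin D$ or $y\notin D$. $K_3^X(s)=\sup_{|x-y|\ge s/8}G_{B(0,s)}(x,y)$, $s>0$. $X$ is a symmetric jump-paring Lévy process if: (i) there are a non-increasing $g:(0,\infty)\to(0,\infty)$ and a constant $C_5\ge1$ with $C_5^{-1}g(|x|)\le\nu(x)\le C_5g(|x|)$, $x\neq0$; there is $C_6$ with $g(|x|)\le C_6g(|x|+1)$ for $|x|\ge1$; there is $C_7$ with $\int_{|x-y|>1,|y|>1}g(|x-y|)g(|y|)dy\le C_7g(|x|)$ for $|x|\ge1$; (ii) there is $t_{\rm b}>0$ with $\sup_xp(t_{\rm b},x)=p(t_{\rm b},0)<\infty$; (iii) for all $0<p<q<r<\infty$, $\sup_{x\in B(0,p)}\sup_{y\in B(0,q)^c}G_{B(0,r)}(x,y)<\infty$. Harmonicity. A non-negative Borel function $f$ on $\mathbb{R}^d$ is $(X,\eta)$-harmonic in an open set $D$ if $f(x)=\mathbf{E}^x[\tau_U<\infty;\,e^{-\eta\tau_U}f(X_{\tau_U})]$, $x\in U$, for every open $U$ with $\overline U\subset D$. *)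

theory Defs
  imports "HOL-Probability.Probability"
begin

section \<open>Symmetric Levy processes\<close>

locale levy_process = prob_space M for M :: "'w measure" +
  fixes X :: "real \<Rightarrow> 'w \<Rightarrow> real ^ 'n"
  assumes measurable_X: "\<And>t. 0 \<le> t \<Longrightarrow> X t \<in> borel_measurable M"
    and start: "AE \<omega> in M. X 0 \<omega> = 0"
    and independent_increments:
      "\<And>(k :: nat) (t :: nat \<Rightarrow> real). 0 \<le> t 0 \<Longrightarrow> (\<And>i. i < k \<Longrightarrow> t i < t (Suc i)) \<Longrightarrow>
         indep_vars (\<lambda>_. borel) (\<lambda>i \<omega>. X (t (Suc i)) \<omega> - X (t i) \<omega>) {..<k}"
    and stationary_increments:
      "\<And>s t. 0 \<le> s \<Longrightarrow> 0 \<le> t \<Longrightarrow>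
         distr M borel (\<lambda>\<omega>. X (s + t) \<omega> - X s \<omega>) = distr M borel (X t)"
    and cadlag:
      "AE \<omega> in M. (\<forall>t\<ge>0. ((\<lambda>s. X s \<omega>) \<longlongrightarrow> X t \<omega>) (at_right t)) \<and>
                   (\<forall>t>0. \<exists>l. ((\<lambda>s. X s \<omega>) \<longlongrightarrow> l) (at_left t))"

text \<open>A function \<open>\<nu>\<close> stands for the measure with density \<open>\<nu>\<close>. The value \<open>\<nu> 0\<close> is arbitrary;
  it never matters, because \<open>{0}\<close> is a Lebesgue null set.\<close>

definition levy_measure :: "(real ^ 'n \<Rightarrow> real) \<Rightarrow> (real ^ 'n) measure" where
  "levy_measure \<nu> = density lborel (\<lambda>z. ennreal (\<nu> z))"

definition levy_exponent :: "real ^ 'n ^ 'n \<Rightarrow> (real ^ 'n \<Rightarrow> real) \<Rightarrow> real ^ 'n \<Rightarrow> real" where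
  "levy_exponent A \<nu> \<xi> = (A *v \<xi>) \<bullet> \<xi> + (LINT z|levy_measure \<nu>. 1 - cos (\<xi> \<bullet> z))"

definition sup_levy_exponent :: "real ^ 'n ^ 'n \<Rightarrow> (real ^ 'n \<Rightarrow> real) \<Rightarrow> real \<Rightarrow> real" where
  "sup_levy_exponent A \<nu> r = (SUP \<xi>\<in>cball 0 r. levy_exponent A \<nu> \<xi>)"

text \<open>The transition densities \<open>p t\<close> are only determined almost everywhere by the process; the locale
  admits every jointly measurable choice. They take values in \<^typ>\<open>ennreal\<close> because the natural
  (lower semicontinuous) choice can be infinite at the origin for small \<open>t\<close>.\<close>

locale symmetric_levy_process = levy_process M X
  for M :: "'w measure" and X :: "real \<Rightarrow> 'w \<Rightarrow> real ^ 'n" +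
  fixes A :: "real ^ 'n ^ 'n" and \<nu> :: "real ^ 'n \<Rightarrow> real" and p :: "real \<Rightarrow> real ^ 'n \<Rightarrow> ennreal"
  assumes A_symmetric: "transpose A = A"
    and A_nonneg: "\<And>\<xi>. 0 \<le> (A *v \<xi>) \<bullet> \<xi>"
    and measurable_\<nu>: "\<nu> \<in> borel_measurable borel"
    and \<nu>_pos: "\<And>x. x \<noteq> 0 \<Longrightarrow> 0 < \<nu> x"
    and \<nu>_symmetric: "distr (levy_measure \<nu>) borel uminus = levy_measure \<nu>"
    and \<nu>_levy: "(\<integral>\<^sup>+ z. ennreal (min 1 ((norm z)\<^sup>2)) \<partial>levy_measure \<nu>) < \<infinity>"
    and \<nu>_infinite: "emeasure (levy_measure \<nu>) (UNIV - {0}) = \<infinity>"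
    and characteristic_function:
      "\<And>t \<xi>. 0 \<le> t \<Longrightarrow>
         (CLINT \<omega>|M. iexp (\<xi> \<bullet> X t \<omega>)) = complex_of_real (exp (- t * levy_exponent A \<nu> \<xi>))"
    and measurable_p:
      "(\<lambda>(t, x). p t x) \<in> borel_measurable (restrict_space borel ({0<..} \<times> UNIV))"
    and transition_density: "\<And>t. 0 < t \<Longrightarrow> distributed M lborel (X t) (p t)"


section \<open>Exit times, killed densities and Green functions\<close>

text \<open>The law \<open>P\<^sup>x\<close> of the process started at \<open>x\<close> is the law of \<open>\<lambda>t. x + X t\<close> under \<open>M\<close>.
  Exit times and the positions at exit are in general measurable only with respect to the completion
  of \<open>M\<close>. The expectations below are nonnegative integrals, and these agree for \<open>M\<close> and its
  completion on arbitrary integrands (lemma \<open>nn_integral_completion\<close>).\<close>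

definition exit_time :: "(real \<Rightarrow> 'w \<Rightarrow> real ^ 'n) \<Rightarrow> real ^ 'n \<Rightarrow> (real ^ 'n) set \<Rightarrow> 'w \<Rightarrow> ennreal" where
  "exit_time X x D \<omega> = Inf (ennreal ` {t. 0 \<le> t \<and> x + X t \<omega> \<notin> D})"

definition exit_position :: "(real \<Rightarrow> 'w \<Rightarrow> real ^ 'n) \<Rightarrow> real ^ 'n \<Rightarrow> (real ^ 'n) set \<Rightarrow> 'w \<Rightarrow> real ^ 'n" where
  "exit_position X x D \<omega> = x + X (enn2real (exit_time X x D \<omega>)) \<omega>"

text \<open>Hunt's formula. Subtraction on \<^typ>\<open>ennreal\<close> is truncated at \<open>0\<close>; for every \<open>t\<close> and \<open>x\<close>,
  the minuend dominates the subtrahend for almost every \<open>y\<close>.\<close>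

definition killed_density ::
  "'w measure \<Rightarrow> (real \<Rightarrow> 'w \<Rightarrow> real ^ 'n) \<Rightarrow> (real \<Rightarrow> real ^ 'n \<Rightarrow> ennreal) \<Rightarrow> (real ^ 'n) set \<Rightarrow>
    real \<Rightarrow> real ^ 'n \<Rightarrow> real ^ 'n \<Rightarrow> ennreal" where
  "killed_density M X p D t x y =
     p t (y - x) -
     (\<integral>\<^sup>+ \<omega>. (if exit_time X x D \<omega> < ennreal t
             then p (t - enn2real (exit_time X x D \<omega>)) (y - exit_position X x D \<omega>)
             else 0) \<partial>M)"

definition green_function ::
  "'w measure \<Rightarrow> (real \<Rightarrow> 'w \<Rightarrow> real ^ 'n) \<Rightarrow> (real \<Rightarrow> real ^ 'n \<Rightarrow> ennreal) \<Rightarrow> (real ^ 'n) set \<Rightarrow>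
    real ^ 'n \<Rightarrow> real ^ 'n \<Rightarrow> ennreal" where
  "green_function M X p D x y =
     (if x \<in> D \<and> y \<in> D then \<integral>\<^sup>+ t\<in>{0<..}. killed_density M X p D t x y \<partial>lborel else 0)"

definition K3 ::
  "'w measure \<Rightarrow> (real \<Rightarrow> 'w \<Rightarrow> real ^ 'n) \<Rightarrow> (real \<Rightarrow> real ^ 'n \<Rightarrow> ennreal) \<Rightarrow> real \<Rightarrow> ennreal" where
  "K3 M X p s = (SUP (x, y)\<in>{(x, y). norm (x - y) \<ge> s / 8}. green_function M X p (ball 0 s) x y)"


section \<open>Jump-paring processes and harmonic functions\<close>

locale jump_paring_levy_process = symmetric_levy_process M X A \<nu> p
  for M :: "'w measure" and X :: "real \<Rightarrow> 'w \<Rightarrow> real ^ 'n" and A \<nu> p +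
  assumes jump_paring:
      "\<exists>(g :: real \<Rightarrow> real) C5 C6 C7.
         (\<forall>u>0. 0 < g u) \<and> antimono_on {0<..} g \<and>
         1 \<le> C5 \<and> (\<forall>x. x \<noteq> 0 \<longrightarrow> inverse C5 * g (norm x) \<le> \<nu> x \<and> \<nu> x \<le> C5 * g (norm x)) \<and>
         (\<forall>x :: real ^ 'n. 1 \<le> norm x \<longrightarrow> g (norm x) \<le> C6 * g (norm x + 1)) \<and>
         (\<forall>x :: real ^ 'n. 1 \<le> norm x \<longrightarrow>
            (\<integral>\<^sup>+ y\<in>{y. 1 < norm (x - y) \<and> 1 < norm y}. ennreal (g (norm (x - y)) * g (norm y)) \<partial>lborel)
              \<le> ennreal (C7 * g (norm x)))"
    and bounded_density: "\<exists>t\<^sub>b>0. (SUP x. p t\<^sub>b x) = p t\<^sub>b 0 \<and> p t\<^sub>b 0 < \<infinity>"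
    and bounded_green:
      "\<And>a b c. 0 < a \<Longrightarrow> a < b \<Longrightarrow> b < c \<Longrightarrow>
         (SUP x\<in>ball 0 a. SUP y\<in>- ball 0 b. green_function M X p (ball 0 c) x y) < \<infinity>"

definition harmonic_in ::
  "'w measure \<Rightarrow> (real \<Rightarrow> 'w \<Rightarrow> real ^ 'n) \<Rightarrow> real \<Rightarrow> (real ^ 'n) set \<Rightarrow> (real ^ 'n \<Rightarrow> real) \<Rightarrow> bool" where
  "harmonic_in M X \<eta> D f \<longleftrightarrow>
     f \<in> borel_measurable borel \<and> (\<forall>x. 0 \<le> f x) \<and>
     (\<forall>U. open U \<and> closure U \<subseteq> D \<longrightarrow> (\<forall>x\<in>U.
        ennreal (f x) =
        (\<integral>\<^sup>+ \<omega>. (if exit_time X x U \<omega> < \<infinity>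
                then ennreal (exp (- \<eta> * enn2real (exit_time X x U \<omega>)) * f (exit_position X x U \<omega>))
                else 0) \<partial>M)))"

end

theory Submission
  imports Defs "HOL-Real_Asymp.Real_Asymp"
begin

text \<open>
  Taking for \<open>U\<close> the complement of the closed ball of radius \<open>2 r\<close> in the definition of harmonicity
  bounds \<open>f x\<close> by \<open>\<parallel>f\<parallel>\<close> times the Laplace transform at \<open>\<eta>\<close> of the hitting time of that ball, so
  that it suffices to construct a function \<open>w\<close>, bounded below on a large ball and
  comparable with \<open>\<nu>\<close> far away, for which \<open>exp (- \<eta> t) w (x + X t)\<close> is a supermartingale.

  The first hypothesis makes the radial profile \<open>g\<close> of \<open>\<nu>\<close> doubling on \<open>[1, \<infinity>)\<close>. Put \<open>s\<^sub>k = 2\<^sup>k R\<close> and let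
  \<open>w\<close> be the mixture of the Gaussians \<open>exp (- |y|\<^sup>2 / (2 s\<^sub>k\<^sup>2))\<close> with weights \<open>g s\<^sub>k - g s\<^sub>k\<^sub>+\<^sub>1\<close>; by doubling
  \<open>w y\<close> is comparable with \<open>g (max |y| R)\<close>, with constants independent of \<open>R\<close>. Gaussians are
  superpositions of characters, so the generator applied to \<open>w\<close> can be read off from the
  characteristic exponent and equals a second order term plus an integral of second
  differences of \<open>w\<close> against \<open>\<nu>\<close>. Jumps longer than \<open>l = max |y| R / 8\<close> contribute at most a multiple of
  \<open>g l\<close> times the integral of \<open>w\<close>, the rest is at most \<open>o(1) w y\<close>. The integral of \<open>w\<close> also tends
  to \<open>0\<close> as \<open>R\<close> grows, so for large \<open>R\<close> the generator applied to \<open>w\<close> is at most \<open>\<eta> w\<close> everywhere.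
\<close>

section \<open>The Gaussian measure\<close>

text \<open>Built from independent coordinates so that characters factor over them. It serves as the
  law of a random frequency \<xi>: averaging cosines over it gives back a Gaussian in the space
  variable, so no Fourier inversion is needed.\<close>

definition std_gaussian :: "(real ^ 'n) measure" where
  "std_gaussian = distr (PiM UNIV (\<lambda>_ :: 'n. std_normal_distribution)) borel (\<lambda>\<omega>. \<chi> i. \<omega> i)"

lemma measurable_vec_lambda_PiM [measurable]:
  "(\<lambda>\<omega>. \<chi> i. \<omega> i) \<in> borel_measurable (PiM UNIV (\<lambda>_ :: 'n::finite. std_normal_distribution))"
proof (subst borel_measurable_euclidean_space, intro ballI)
  fix b :: "real ^ 'n"
  assume "b \<in> Basis"
  then obtain i where b: "b = axis i 1"
    by (auto simp: Basis_vec_def)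
  show "(\<lambda>\<omega>. (\<chi> i. \<omega> i) \<bullet> b) \<in> borel_measurable (PiM UNIV (\<lambda>_ :: 'n. std_normal_distribution))"
    unfolding b by (simp add: inner_axis)
qed

lemma sets_std_gaussian [simp, measurable_cong]: "sets std_gaussian = sets borel"
  by (simp add: std_gaussian_def)

lemma space_std_gaussian [simp]: "space std_gaussian = UNIV"
  by (simp add: std_gaussian_def)

lemma prob_space_std_gaussian: "prob_space (std_gaussian :: (real ^ 'n) measure)"
  unfolding std_gaussian_def
  by (intro prob_space.prob_space_distr prob_space_PiM prob_space_normal_density) simp_all

interpretation std_gaussian: prob_space "std_gaussian :: (real ^ 'n) measure"
  by (rule prob_space_std_gaussian)

lemma char_std_gaussian:
  fixes x :: "real ^ 'n"
  shows "(CLINT \<xi>|std_gaussian. iexp (x \<bullet> \<xi>)) = complex_of_real (exp (- (norm x)\<^sup>2 / 2))"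
proof -
  interpret N: product_prob_space "\<lambda>_ :: 'n. std_normal_distribution" UNIV
    by (intro product_prob_spaceI prob_space_normal_density) simp
  have "(CLINT \<xi>|std_gaussian. iexp (x \<bullet> \<xi>))
      = (\<integral>\<omega>. iexp (x \<bullet> (\<chi> i. \<omega> i)) \<partial>PiM UNIV (\<lambda>_ :: 'n. std_normal_distribution))"
    unfolding std_gaussian_def by (rule integral_distr) simp_all
  also have "\<dots> = (\<integral>\<omega>. (\<Prod>i\<in>UNIV. iexp (x $ i * \<omega> i)) \<partial>PiM UNIV (\<lambda>_ :: 'n. std_normal_distribution))"
    by (simp add: inner_vec_def exp_sum[symmetric] sum_distrib_left)
  also have "\<dots> = (\<Prod>i\<in>UNIV. char std_normal_distribution (x $ i))"
  proof (subst N.product_integral_prod)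
    have "finite_measure std_normal_distribution"
      using prob_space_normal_density[of 1 0] by (simp add: prob_space_def)
    then show "integrable std_normal_distribution (\<lambda>s. iexp (x $ i * s))" for i
      by (intro finite_measure.integrable_const_bound[where B = 1]) simp_all
  qed (simp_all add: char_def)
  also have "\<dots> = complex_of_real (\<Prod>i\<in>UNIV. exp (- ((x $ i)\<^sup>2) / 2))"
    by (simp add: char_std_normal_distribution)
  also have "(\<Prod>i\<in>UNIV. exp (- ((x $ i)\<^sup>2) / 2)) = exp (- (norm x)\<^sup>2 / 2)"
    by (simp add: exp_sum[symmetric] sum_divide_distrib[symmetric] sum_negf norm_vec_def L2_set_def sum_nonneg)
  finally show ?thesis .
qed

lemma integral_cos_std_gaussian:
  fixes x :: "real ^ 'n"
  shows "(LINT \<xi>|std_gaussian. cos (x \<bullet> \<xi>)) = exp (- (norm x)\<^sup>2 / 2)"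
proof -
  have "complex_integrable std_gaussian (\<lambda>\<xi> :: real ^ 'n. iexp (x \<bullet> \<xi>))"
    by (intro std_gaussian.integrable_const_bound[where B = 1]) simp_all
  then have "(LINT \<xi>|std_gaussian. Re (iexp (x \<bullet> \<xi>))) = Re (CLINT \<xi>|std_gaussian. iexp (x \<bullet> \<xi>))"
    by (rule integral_Re)
  then show ?thesis
    by (simp add: char_std_gaussian Re_exp)
qed

text \<open>The second-order error in time involves the square of the characteristic exponent, which
  grows at most like |\<xi>|^4; this moment controls it.\<close>

lemma integrable_std_gaussian_norm_power4:
  "integrable std_gaussian (\<lambda>\<xi> :: real ^ 'n. (norm \<xi>) ^ 4)"
proof -
  interpret N: product_prob_space "\<lambda>_ :: 'n. std_normal_distribution" UNIV
    by (intro product_prob_spaceI prob_space_normal_density) simp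
  have N4: "integrable std_normal_distribution (\<lambda>s. s ^ 4)"
    by (subst integrable_density) (auto simp: normal_density_nonneg integrable_std_normal_moment)
  have comp: "integrable std_gaussian (\<lambda>\<xi> :: real ^ 'n. (\<xi> $ i) ^ 4)" for i
  proof -
    have "integrable (distr (PiM UNIV (\<lambda>_ :: 'n. std_normal_distribution)) std_normal_distribution (\<lambda>\<omega>. \<omega> i))
            (\<lambda>s. s ^ 4)"
      using N4 N.PiM_component[of i] by simp
    then have "integrable (PiM UNIV (\<lambda>_ :: 'n. std_normal_distribution)) (\<lambda>\<omega>. (\<omega> i) ^ 4)"
      by (subst (asm) integrable_distr_eq) simp_all
    then show ?thesis
      unfolding std_gaussian_def by (subst integrable_distr_eq) simp_all
  qed
  \<comment> \<open>Cauchy-Schwarz for the vector of squared coordinates against the constant vector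
    1.\<close>
  have bound: "(norm \<xi>) ^ 4 \<le> real CARD('n) * (\<Sum>i\<in>UNIV. (\<xi> $ i) ^ 4)" for \<xi> :: "real ^ 'n"
  proof -
    have "(norm \<xi>) ^ 4 = (\<Sum>i\<in>UNIV. (\<xi> $ i)\<^sup>2)\<^sup>2"
      by (simp add: norm_vec_def L2_set_def sum_nonneg power4_eq_xxxx flip: power2_eq_square power_mult_distrib)
        (simp add: power4_eq_xxxx power2_eq_square sum_nonneg)
    also have "\<dots> \<le> real CARD('n) * (\<Sum>i\<in>UNIV. ((\<xi> $ i)\<^sup>2)\<^sup>2)"
      using Cauchy_Schwarz_ineq_sum[of "\<lambda>i. (\<xi> $ i)\<^sup>2" "\<lambda>_. 1" UNIV] by (simp add: mult.commute)
    finally show ?thesis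
      by simp
  qed
  show ?thesis
    by (rule Bochner_Integration.integrable_bound[where f = "\<lambda>\<xi>. real CARD('n) * (\<Sum>i\<in>UNIV. (\<xi> $ i) ^ 4)"])
      (use bound in \<open>auto intro!: Bochner_Integration.integrable_sum integrable_mult_right comp order_trans[OF bound]\<close>)
qed

section \<open>Second differences of Gaussian functions\<close>

definition gauss :: "real \<Rightarrow> 'a::real_inner \<Rightarrow> real" where
  "gauss \<sigma> y = exp (- (norm y)\<^sup>2 / (2 * \<sigma>\<^sup>2))"

text \<open>The halving matches the exponent: on cos (\<xi> \<bullet> y) the operation is
  multiplication by cos (\<xi> \<bullet> z) - 1. Symmetry in z allows integration of small jumps
  against \<nu> without a drift compensator.\<close>

definition second_diff :: "('a::real_vector \<Rightarrow> real) \<Rightarrow> 'a \<Rightarrow> 'a \<Rightarrow> real" where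
  "second_diff f z y = (f (y + z) + f (y - z)) / 2 - f y"

lemma gauss_pos: "0 < gauss \<sigma> y"
  by (simp add: gauss_def)

lemma gauss_le_1: "gauss \<sigma> y \<le> 1"
  by (simp add: gauss_def)

lemma measurable_gauss [measurable]:
  "gauss \<sigma> \<in> borel_measurable (borel :: 'a::euclidean_space measure)"
  unfolding gauss_def by measurable

lemma gauss_two_mult: "gauss (2 * \<sigma>) y = exp (- (norm y)\<^sup>2 / (8 * \<sigma>\<^sup>2))"
  by (simp add: gauss_def power_mult_distrib)

lemma gauss_le_gauss_two_mult: "0 < \<sigma> \<Longrightarrow> gauss \<sigma> y \<le> gauss (2 * \<sigma>) y"
  unfolding gauss_two_mult unfolding gauss_def by (simp add: frac_le)

text \<open>Average the second-order Taylor bounds for the exponential at a and at -a; the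
  first-order terms cancel.\<close>

lemma cosh_minus_1_le:
  fixes a :: real
  shows "cosh a - 1 \<le> a\<^sup>2 / 2 * exp \<bar>a\<bar>"
proof -
  have "exp b \<le> 1 + b + b\<^sup>2 / 2 * exp \<bar>a\<bar>" if "\<bar>b\<bar> = \<bar>a\<bar>" for b :: real
  proof -
    obtain t where t: "\<bar>t\<bar> \<le> \<bar>b\<bar>" "exp b = (\<Sum>m<2. b ^ m / fact m) + exp t / fact 2 * b ^ 2"
      using Maclaurin_exp_le[of b 2] by blast
    have "exp t \<le> exp \<bar>a\<bar>"
      using t(1) that by simp
    then have "exp t / 2 * b\<^sup>2 \<le> exp \<bar>a\<bar> / 2 * b\<^sup>2"
      by (intro mult_right_mono) auto
    then show ?thesis
      using t(2) by (simp add: eval_nat_numeral algebra_simps)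
  qed
  from this[of a] this[of "- a"] show ?thesis
    by (simp add: cosh_def field_simps)
qed

lemma second_diff_gauss:
  "second_diff (gauss \<sigma>) z y
     = gauss \<sigma> y * (exp (- (norm z)\<^sup>2 / (2 * \<sigma>\<^sup>2)) * cosh ((y \<bullet> z) / \<sigma>\<^sup>2) - 1)"
proof -
  have plus: "gauss \<sigma> (y + z) = gauss \<sigma> y * exp (- (norm z)\<^sup>2 / (2 * \<sigma>\<^sup>2)) * exp (- ((y \<bullet> z) / \<sigma>\<^sup>2))"
    and minus: "gauss \<sigma> (y - z) = gauss \<sigma> y * exp (- (norm z)\<^sup>2 / (2 * \<sigma>\<^sup>2)) * exp ((y \<bullet> z) / \<sigma>\<^sup>2)"
    unfolding gauss_def power2_norm_eq_inner exp_add[symmetric]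
    by (auto simp: inner_add inner_diff inner_commute add_divide_distrib diff_divide_distrib)
  show ?thesis
    unfolding second_diff_def plus minus by (simp add: cosh_def field_simps)
qed

text \<open>Put u = |y| / \<sigma>. The cosh in the exact formula costs at most exp (|y \<bullet> z|
  / \<sigma>^2), and the restriction on z keeps this below a constant times exp (3 u^2 / 16). Of the
  decay exp (- u^2 / 2) there remain exp (- u^2 / 4) and a factor exp (- u^2 / 16), which absorbs
  u^2. The price is a wider Gaussian.\<close>

lemma abs_second_diff_gauss_le:
  fixes y z :: "'a::real_inner"
  assumes \<sigma>: "0 < \<sigma>" and z: "norm z \<le> max (norm y) \<sigma> / 8"
  shows "\<bar>second_diff (gauss \<sigma>) z y\<bar> \<le> 16 * ((norm z)\<^sup>2 / \<sigma>\<^sup>2) * exp (- (norm y)\<^sup>2 / (4 * \<sigma>\<^sup>2))"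
proof -
  define u where "u = norm y / \<sigma>"
  define a where "a = (y \<bullet> z) / \<sigma>\<^sup>2"
  define m where "m = (norm z)\<^sup>2 / \<sigma>\<^sup>2"
  have u: "0 \<le> u" and m: "0 \<le> m" and u2: "(norm y)\<^sup>2 / \<sigma>\<^sup>2 = u\<^sup>2"
    using \<sigma> by (simp_all add: u_def m_def power_divide)
  have gy: "gauss \<sigma> y = exp (- u\<^sup>2 / 2)"
    unfolding gauss_def u2[symmetric] by simp
  have um: "sqrt m = norm z / \<sigma>"
    unfolding m_def using \<sigma> by (simp add: real_sqrt_divide)
  have absa: "\<bar>a\<bar> \<le> u * sqrt m"
    unfolding a_def u_def um using Cauchy_Schwarz_ineq2[of y z] \<sigma>
    by (simp add: power2_eq_square divide_right_mono)
  have "sqrt m \<le> (u + 1) / 8"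
    unfolding um u_def using z \<sigma> by (auto simp: field_simps max_def split: if_splits)
      (use norm_ge_zero[of y] in linarith)
  then have "u * sqrt m \<le> u * ((u + 1) / 8)"
    using u by (intro mult_left_mono)
  \<comment> \<open>The linear term u / 8 is at most (u^2 + 1) / 16.\<close>
  also have "\<dots> \<le> 3 * u\<^sup>2 / 16 + 1 / 16"
    using zero_le_power2[of "u - 1"] by (simp add: power2_eq_square field_simps)
  finally have a_le: "\<bar>a\<bar> \<le> 3 * u\<^sup>2 / 16 + 1 / 16"
    using absa by simp
  have a2: "a\<^sup>2 \<le> u\<^sup>2 * m"
    using power_mono[OF absa, of 2] m by (simp add: power_mult_distrib)
  have exp16: "exp (1 / 16 :: real) \<le> 2"
    using exp_bound[of "1 / 16 :: real"] by (simp add: power2_eq_square)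
  have "u\<^sup>2 / 16 \<le> exp (u\<^sup>2 / 16)"
    using exp_ge_add_one_self[of "u\<^sup>2 / 16"] by linarith
  then have u16: "u\<^sup>2 * exp (- (u\<^sup>2 / 16)) \<le> 16"
    by (simp add: exp_minus field_simps)
  have "exp (- u\<^sup>2 / 2) * (cosh a - 1) \<le> exp (- u\<^sup>2 / 2) * (a\<^sup>2 / 2 * exp \<bar>a\<bar>)"
    by (intro mult_left_mono cosh_minus_1_le) simp
  also have "\<dots> \<le> exp (- u\<^sup>2 / 2) * (u\<^sup>2 * m / 2 * exp (3 * u\<^sup>2 / 16 + 1 / 16))"
    using a2 a_le m by (intro mult_left_mono mult_mono) auto
  also have "\<dots> = m / 2 * (exp (1 / 16) * (u\<^sup>2 * exp (- (u\<^sup>2 / 16)))) * exp (- u\<^sup>2 / 4)"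
    by (simp add: algebra_simps flip: exp_add)
  also have "\<dots> \<le> m / 2 * (2 * 16) * exp (- u\<^sup>2 / 4)"
    using m exp16 u16 by (intro mult_right_mono mult_left_mono mult_mono) auto
  finally have upper: "exp (- u\<^sup>2 / 2) * (cosh a - 1) \<le> 16 * m * exp (- u\<^sup>2 / 4)"
    by simp
  have expm: "1 - m / 2 \<le> exp (- m / 2)" "exp (- m / 2) \<le> 1"
    using exp_ge_add_one_self[of "- m / 2"] m by auto
  have cosh1: "1 \<le> cosh a"
    by (rule cosh_real_ge_1)
  have eq: "second_diff (gauss \<sigma>) z y = exp (- u\<^sup>2 / 2) * (exp (- m / 2) * cosh a - 1)"
    unfolding second_diff_gauss gy a_def m_def by simp
  have "exp (- m / 2) * cosh a - 1 \<le> cosh a - 1"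
    using expm cosh1 mult_right_mono[of "exp (- m / 2)" 1 "cosh a"] by simp
  then have "second_diff (gauss \<sigma>) z y \<le> exp (- u\<^sup>2 / 2) * (cosh a - 1)"
    unfolding eq by (intro mult_left_mono) auto
  \<comment> \<open>For the lower bound cosh is replaced by 1, which leaves only the loss m / 2 from
    exp (- m / 2).\<close>
  moreover have "- (16 * m * exp (- u\<^sup>2 / 4)) \<le> second_diff (gauss \<sigma>) z y"
  proof -
    have "exp (- m / 2) * 1 \<le> exp (- m / 2) * cosh a"
      by (intro mult_left_mono cosh1) simp
    then have "- (m / 2) \<le> exp (- m / 2) * cosh a - 1"
      using expm(1) by linarith
    then have "exp (- u\<^sup>2 / 2) * - (m / 2) \<le> second_diff (gauss \<sigma>) z y"
      unfolding eq by (intro mult_left_mono) auto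
    moreover have "m / 2 * exp (- u\<^sup>2 / 2) \<le> 16 * m * exp (- u\<^sup>2 / 4)"
      using m by (intro mult_mono) auto
    ultimately show ?thesis
      by (simp add: mult.commute)
  qed
  ultimately have "\<bar>second_diff (gauss \<sigma>) z y\<bar> \<le> 16 * m * exp (- u\<^sup>2 / 4)"
    using upper by linarith
  then show ?thesis
    by (simp add: m_def u2[symmetric] mult.commute)
qed

section \<open>The characteristic exponent\<close>

lemma one_minus_cos_le:
  fixes s :: real
  shows "1 - cos s \<le> s\<^sup>2 / 2"
proof -
  have "1 - cos s = 2 * (sin (s / 2))\<^sup>2"
    using cos_double_sin[of "s / 2"] by simp
  also have "\<dots> \<le> 2 * (s / 2)\<^sup>2"
    using abs_le_square_iff[THEN iffD1, OF abs_sin_x_le_abs_x[of "s / 2"]] by simp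
  finally show ?thesis
    by (simp add: power2_eq_square)
qed

text \<open>Separating off \<open>min 1 ((norm z)\<^sup>2)\<close>, the integrand in the definition
  of a Levy measure, yields integrability in z and quadratic growth in \<xi> at once.\<close>

lemma one_minus_cos_inner_le:
  fixes \<xi> z :: "'a::real_inner"
  shows "1 - cos (\<xi> \<bullet> z) \<le> (2 + (norm \<xi>)\<^sup>2) * min 1 ((norm z)\<^sup>2)"
proof (cases "1 \<le> (norm z)\<^sup>2")
  case True
  then have m: "min 1 ((norm z)\<^sup>2) = 1"
    by simp
  have "1 - cos (\<xi> \<bullet> z) \<le> 2"
    using cos_ge_minus_one[of "\<xi> \<bullet> z"] by linarith
  also have "2 \<le> (2 + (norm \<xi>)\<^sup>2) * min 1 ((norm z)\<^sup>2)"
    unfolding m by simp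
  finally show ?thesis .
next
  case False
  have "1 - cos (\<xi> \<bullet> z) \<le> (\<xi> \<bullet> z)\<^sup>2 / 2"
    by (rule one_minus_cos_le)
  also have "\<dots> \<le> (norm \<xi> * norm z)\<^sup>2 / 2"
    using power_mono[OF Cauchy_Schwarz_ineq2[of \<xi> z], of 2] by simp
  also have "\<dots> \<le> (2 + (norm \<xi>)\<^sup>2) * (norm z)\<^sup>2"
    by (simp add: power_mult_distrib algebra_simps)
  finally show ?thesis
    using False by simp
qed

context symmetric_levy_process
begin

abbreviation \<psi> :: "real ^ 'n \<Rightarrow> real" where
  "\<psi> \<equiv> levy_exponent A \<nu>"

lemma AE_\<nu>_nonneg: "AE z in lborel. 0 \<le> \<nu> z"
proof -
  have "AE z in lborel. z \<noteq> (0 :: real ^ 'n)"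
    by (rule AE_lborel_singleton)
  then show ?thesis
    by eventually_elim (use \<nu>_pos less_imp_le in blast)
qed

lemma integral_levy_measure:
  fixes f :: "real ^ 'n \<Rightarrow> real"
  assumes [measurable]: "f \<in> borel_measurable borel"
  shows "(LINT z|levy_measure \<nu>. f z) = (LINT z|lborel. \<nu> z * f z)"
  unfolding levy_measure_def using AE_\<nu>_nonneg measurable_\<nu>
  by (subst integral_density) auto

lemma integrable_\<nu>_min: "integrable lborel (\<lambda>z. \<nu> z * min 1 ((norm z)\<^sup>2))"
proof (rule integrableI_nn_integral_finite)
  note [measurable] = measurable_\<nu>
  show "(\<lambda>z. \<nu> z * min 1 ((norm z)\<^sup>2)) \<in> borel_measurable lborel"
    by measurable
  show "AE z in lborel. 0 \<le> \<nu> z * min 1 ((norm z)\<^sup>2)"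
    using AE_\<nu>_nonneg by eventually_elim simp
  have "(\<integral>\<^sup>+ z. ennreal (min 1 ((norm z)\<^sup>2)) \<partial>levy_measure \<nu>)
      = (\<integral>\<^sup>+ z. ennreal (\<nu> z) * ennreal (min 1 ((norm z)\<^sup>2)) \<partial>lborel)"
    unfolding levy_measure_def by (subst nn_integral_density) auto
  also have "\<dots> = (\<integral>\<^sup>+ z. ennreal (\<nu> z * min 1 ((norm z)\<^sup>2)) \<partial>lborel)"
    using AE_\<nu>_nonneg by (intro nn_integral_cong_AE, eventually_elim) (simp add: ennreal_mult')
  finally show "(\<integral>\<^sup>+ z. ennreal (\<nu> z * min 1 ((norm z)\<^sup>2)) \<partial>lborel)
      = ennreal (enn2real (\<integral>\<^sup>+ z. ennreal (min 1 ((norm z)\<^sup>2)) \<partial>levy_measure \<nu>))"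
    using \<nu>_levy by simp
qed

lemma integrable_\<nu>_mult:
  fixes f :: "real ^ 'n \<Rightarrow> real"
  assumes [measurable]: "f \<in> borel_measurable borel" and f: "\<And>z. \<bar>f z\<bar> \<le> C * min 1 ((norm z)\<^sup>2)"
  shows "integrable lborel (\<lambda>z. \<nu> z * f z)"
proof (rule Bochner_Integration.integrable_bound)
  note [measurable] = measurable_\<nu>
  show "integrable lborel (\<lambda>z. C * (\<nu> z * min 1 ((norm z)\<^sup>2)))"
    by (intro integrable_mult_right integrable_\<nu>_min)
  show "(\<lambda>z. \<nu> z * f z) \<in> borel_measurable lborel"
    by measurable
  show "AE z in lborel. norm (\<nu> z * f z) \<le> norm (C * (\<nu> z * min 1 ((norm z)\<^sup>2)))"
    using AE_\<nu>_nonneg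
  proof eventually_elim
    case (elim z)
    have "\<bar>\<nu> z * f z\<bar> = \<nu> z * \<bar>f z\<bar>"
      using elim by (simp add: abs_mult)
    also have "\<dots> \<le> \<nu> z * (C * min 1 ((norm z)\<^sup>2))"
      by (intro mult_left_mono f elim)
    finally show ?case
      by (simp add: algebra_simps)
  qed
qed

lemma levy_exponent_eq:
  "\<psi> \<xi> = (A *v \<xi>) \<bullet> \<xi> + (LINT z|lborel. \<nu> z * (1 - cos (\<xi> \<bullet> z)))"
  unfolding levy_exponent_def by (subst integral_levy_measure) simp_all

lemma integrable_\<nu>_cos: "integrable lborel (\<lambda>z. \<nu> z * (1 - cos (\<xi> \<bullet> z)))"
  by (rule integrable_\<nu>_mult[where C = "2 + (norm \<xi>)\<^sup>2"]) (simp_all add: one_minus_cos_inner_le)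

lemma levy_exponent_nonneg: "0 \<le> \<psi> \<xi>"
  unfolding levy_exponent_eq
proof (intro add_nonneg_nonneg A_nonneg integral_nonneg_AE)
  show "AE z in lborel. 0 \<le> \<nu> z * (1 - cos (\<xi> \<bullet> z))"
    using AE_\<nu>_nonneg by eventually_elim simp
qed

lemma abs_quadratic_form_le:
  fixes B :: "real ^ 'n ^ 'n"
  shows "\<bar>(B *v \<xi>) \<bullet> \<xi>\<bar> \<le> (\<Sum>i\<in>UNIV. \<Sum>j\<in>UNIV. \<bar>B $ i $ j\<bar>) * (norm \<xi>)\<^sup>2"
proof -
  have "(B *v \<xi>) \<bullet> \<xi> = (\<Sum>i\<in>UNIV. \<Sum>j\<in>UNIV. B $ i $ j * (\<xi> $ i * \<xi> $ j))"
    by (simp add: inner_vec_def matrix_vector_mult_def sum_distrib_right sum_distrib_left algebra_simps)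
  also have "\<bar>\<dots>\<bar> \<le> (\<Sum>i\<in>UNIV. \<Sum>j\<in>UNIV. \<bar>B $ i $ j\<bar> * (norm \<xi>)\<^sup>2)"
  proof (intro order_trans[OF sum_abs] sum_mono)
    fix i j
    have "\<bar>\<xi> $ i\<bar> * \<bar>\<xi> $ j\<bar> \<le> norm \<xi> * norm \<xi>"
      by (intro mult_mono component_le_norm_cart) auto
    then show "\<bar>B $ i $ j * (\<xi> $ i * \<xi> $ j)\<bar> \<le> \<bar>B $ i $ j\<bar> * (norm \<xi>)\<^sup>2"
      by (simp add: abs_mult power2_eq_square mult_left_mono)
  qed
  finally show ?thesis
    by (simp add: sum_distrib_right)
qed

text \<open>Quadratic growth is what makes the exponent and its square integrable against a Gaussian
  frequency law.\<close>

lemma levy_exponent_le: "\<exists>C\<ge>0. \<forall>\<xi>. \<psi> \<xi> \<le> C * (1 + (norm \<xi>)\<^sup>2)"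
proof -
  define a where "a = (\<Sum>i\<in>UNIV. \<Sum>j\<in>UNIV. \<bar>A $ i $ j\<bar>)"
  define I where "I = (LINT z|lborel. \<nu> z * min 1 ((norm z)\<^sup>2))"
  have a: "0 \<le> a"
    by (simp add: a_def sum_nonneg)
  have I: "0 \<le> I"
    unfolding I_def using AE_\<nu>_nonneg by (intro integral_nonneg_AE, eventually_elim) simp
  have "\<psi> \<xi> \<le> (a + 2 * I) * (1 + (norm \<xi>)\<^sup>2)" for \<xi>
  proof -
    have "(LINT z|lborel. \<nu> z * (1 - cos (\<xi> \<bullet> z)))
        \<le> (LINT z|lborel. (2 + (norm \<xi>)\<^sup>2) * (\<nu> z * min 1 ((norm z)\<^sup>2)))"
    proof (rule integral_mono_AE)
      show "AE z in lborel. \<nu> z * (1 - cos (\<xi> \<bullet> z)) \<le> (2 + (norm \<xi>)\<^sup>2) * (\<nu> z * min 1 ((norm z)\<^sup>2))"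
        using AE_\<nu>_nonneg
      proof eventually_elim
        case (elim z)
        then show ?case
          using mult_left_mono[OF one_minus_cos_inner_le[of \<xi> z], of "\<nu> z"] by (simp add: algebra_simps)
      qed
    qed (intro integrable_\<nu>_cos integrable_mult_right integrable_\<nu>_min)+
    also have "\<dots> = (2 + (norm \<xi>)\<^sup>2) * I"
      by (simp add: I_def)
    finally have "\<psi> \<xi> \<le> a * (norm \<xi>)\<^sup>2 + (2 + (norm \<xi>)\<^sup>2) * I"
      unfolding levy_exponent_eq using abs_quadratic_form_le[of A \<xi>] by (simp add: a_def)
    also have "\<dots> \<le> (a + 2 * I) * (1 + (norm \<xi>)\<^sup>2)"
      using a I by (simp add: algebra_simps)
    finally show ?thesis .
  qed
  then show ?thesis
    using a I by (intro exI[of _ "a + 2 * I"]) auto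
qed

text \<open>The exponent is real, so the sine of \<xi> \<bullet> X t has mean zero and only the
  cosine part of the addition formula survives.\<close>

lemma expectation_cos_increment:
  assumes t: "0 \<le> t"
  shows "expectation (\<lambda>\<omega>. cos ((x + X t \<omega>) \<bullet> \<xi>)) = cos (x \<bullet> \<xi>) * exp (- t * \<psi> \<xi>)"
proof -
  note [measurable] = measurable_X[OF t]
  have 1: "complex_integrable M (\<lambda>\<omega>. iexp (\<xi> \<bullet> X t \<omega>))"
    by (intro integrable_const_bound[where B = 1]) simp_all
  have c: "expectation (\<lambda>\<omega>. cos (\<xi> \<bullet> X t \<omega>)) = exp (- t * \<psi> \<xi>)"
    using arg_cong[OF characteristic_function[OF t, of \<xi>], of Re] integral_Re[OF 1] by (simp add: Re_exp)
  have s: "expectation (\<lambda>\<omega>. sin (\<xi> \<bullet> X t \<omega>)) = 0"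
    using arg_cong[OF characteristic_function[OF t, of \<xi>], of Im] integral_Im[OF 1] by (simp add: Im_exp)
  have "expectation (\<lambda>\<omega>. cos ((x + X t \<omega>) \<bullet> \<xi>))
      = expectation (\<lambda>\<omega>. cos (x \<bullet> \<xi>) * cos (\<xi> \<bullet> X t \<omega>) - sin (x \<bullet> \<xi>) * sin (\<xi> \<bullet> X t \<omega>))"
    by (simp add: inner_add_left inner_add_right cos_add inner_commute)
  also have "\<dots> = cos (x \<bullet> \<xi>) * expectation (\<lambda>\<omega>. cos (\<xi> \<bullet> X t \<omega>))
      - sin (x \<bullet> \<xi>) * expectation (\<lambda>\<omega>. sin (\<xi> \<bullet> X t \<omega>))"
    by (subst Bochner_Integration.integral_diff)
      (auto intro!: integrable_mult_right integrable_const_bound[where B = 1])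
  finally show ?thesis
    by (simp add: c s)
qed

text \<open>The exponent is minus the logarithm of the characteristic function at time 1, a
  measurable parameter integral.\<close>

lemma measurable_levy_exponent [measurable]: "\<psi> \<in> borel_measurable borel"
proof -
  note [measurable] = measurable_X[of 1]
  have "\<psi> = (\<lambda>\<xi>. - ln (expectation (\<lambda>\<omega>. cos ((0 + X 1 \<omega>) \<bullet> \<xi>))))"
    by (subst expectation_cos_increment) (simp_all add: fun_eq_iff)
  also have "\<dots> \<in> borel_measurable borel"
    by measurable
  finally show ?thesis .
qed

end

section \<open>The generator on Gaussian functions\<close>

text \<open>Taylor's remainder with exp t at most 3 when v is at most 1; for larger v already v <=
  v^2 suffices. The bound makes the error in linearising exp (- h \<psi>) of order h^2.\<close>

lemma exp_minus_le_quadratic: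
  fixes v :: real
  assumes "0 \<le> v"
  shows "\<bar>exp (- v) - 1 + v\<bar> \<le> 2 * v\<^sup>2"
proof -
  have "exp (- v) - 1 + v \<le> 2 * v\<^sup>2"
  proof (cases "v \<le> 1")
    case True
    obtain t where t: "\<bar>t\<bar> \<le> \<bar>- v\<bar>" "exp (- v) = (\<Sum>m<2. (- v) ^ m / fact m) + exp t / fact 2 * (- v) ^ 2"
      using Maclaurin_exp_le[of "- v" 2] by blast
    have "exp t \<le> exp 1"
      using t(1) True assms by simp
    also have "\<dots> \<le> 3"
      by (rule exp_le)
    finally have "exp t / 2 * v\<^sup>2 \<le> 2 * v\<^sup>2"
      by (intro mult_right_mono) auto
    then show ?thesis
      using t(2) by (simp add: eval_nat_numeral)
  next
    case False
    then have "v * 1 \<le> v * v"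
      by (intro mult_left_mono) auto
    moreover have "exp (- v) \<le> 1"
      using assms by simp
    ultimately have "exp (- v) - 1 + v \<le> 2 * (v * v)"
      using zero_le_square[of v] by linarith
    then show ?thesis
      by (simp add: power2_eq_square)
  qed
  moreover have "0 \<le> exp (- v) - 1 + v"
    using exp_ge_add_one_self[of "- v"] by simp
  ultimately show ?thesis
    by simp
qed

lemma gauss_fourier:
  fixes y :: "real ^ 'n"
  assumes "0 < \<sigma>"
  shows "(LINT \<xi>|std_gaussian. cos (y \<bullet> (\<xi> /\<^sub>R \<sigma>))) = gauss \<sigma> y"
proof -
  have "(LINT \<xi>|std_gaussian. cos (y \<bullet> (\<xi> /\<^sub>R \<sigma>))) = (LINT \<xi>|std_gaussian. cos ((y /\<^sub>R \<sigma>) \<bullet> \<xi>))"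
    by simp
  also have "\<dots> = gauss \<sigma> y"
    unfolding integral_cos_std_gaussian gauss_def using assms by (simp add: power_mult_distrib field_simps)
  finally show ?thesis .
qed

text \<open>The square of a quadratically growing f is dominated through the fourth moment;
  integrability of f itself then follows from |f| <= 1 + f^2.\<close>

lemma integrable_std_gaussian_quadratic:
  fixes f :: "real ^ 'n \<Rightarrow> real"
  assumes [measurable]: "f \<in> borel_measurable borel" and f: "\<And>\<xi>. \<bar>f \<xi>\<bar> \<le> C * (1 + (norm \<xi>)\<^sup>2)"
  shows "integrable std_gaussian (\<lambda>\<xi>. f (\<xi> /\<^sub>R \<sigma>))" "integrable std_gaussian (\<lambda>\<xi>. (f (\<xi> /\<^sub>R \<sigma>))\<^sup>2)"
proof -
  have i: "integrable std_gaussian (\<lambda>\<xi> :: real ^ 'n. 2 * C\<^sup>2 * (1 + inverse \<sigma> ^ 4 * (norm \<xi>) ^ 4))"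
    by (intro integrable_mult_right Bochner_Integration.integrable_add integrable_std_gaussian_norm_power4) simp
  show sq: "integrable std_gaussian (\<lambda>\<xi>. (f (\<xi> /\<^sub>R \<sigma>))\<^sup>2)"
  proof (rule Bochner_Integration.integrable_bound[OF i], measurable, intro AE_I2)
    fix \<xi> :: "real ^ 'n"
    have "(f (\<xi> /\<^sub>R \<sigma>))\<^sup>2 \<le> (C * (1 + (norm (\<xi> /\<^sub>R \<sigma>))\<^sup>2))\<^sup>2"
      using power_mono[OF f abs_ge_zero, of "\<xi> /\<^sub>R \<sigma>" 2] by simp
    also have "\<dots> \<le> C\<^sup>2 * (2 * (1 + ((norm (\<xi> /\<^sub>R \<sigma>))\<^sup>2)\<^sup>2))"
      unfolding power_mult_distrib
      using zero_le_power2[of "1 - (norm (\<xi> /\<^sub>R \<sigma>))\<^sup>2"]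
      by (intro mult_left_mono) (auto simp: power2_eq_square algebra_simps)
    also have "((norm (\<xi> /\<^sub>R \<sigma>))\<^sup>2)\<^sup>2 = inverse \<sigma> ^ 4 * (norm \<xi>) ^ 4"
      by (simp add: power_mult_distrib power_inverse flip: power_mult)
    finally show "norm ((f (\<xi> /\<^sub>R \<sigma>))\<^sup>2) \<le> norm (2 * C\<^sup>2 * (1 + inverse \<sigma> ^ 4 * (norm \<xi>) ^ 4))"
      by (simp add: algebra_simps)
  qed
  have "integrable std_gaussian (\<lambda>\<xi>. 1 + (f (\<xi> /\<^sub>R \<sigma>))\<^sup>2)"
    by (intro Bochner_Integration.integrable_add sq) simp
  then show "integrable std_gaussian (\<lambda>\<xi>. f (\<xi> /\<^sub>R \<sigma>))"
  proof (rule Bochner_Integration.integrable_bound, measurable, intro AE_I2)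
    fix \<xi> :: "real ^ 'n"
    show "norm (f (\<xi> /\<^sub>R \<sigma>)) \<le> norm (1 + (f (\<xi> /\<^sub>R \<sigma>))\<^sup>2)"
      using zero_le_power2[of "\<bar>f (\<xi> /\<^sub>R \<sigma>)\<bar> - 1 / 2"] by (simp add: power2_diff field_simps)
  qed
qed

lemma integrable_std_gaussian_inner_square:
  fixes v :: "real ^ 'n"
  shows "integrable std_gaussian (\<lambda>\<xi>. (v \<bullet> (\<xi> /\<^sub>R \<sigma>))\<^sup>2)"
proof (rule integrable_std_gaussian_quadratic(1))
  fix \<xi> :: "real ^ 'n"
  have "(v \<bullet> \<xi>)\<^sup>2 \<le> (norm v * norm \<xi>)\<^sup>2"
    using power_mono[OF Cauchy_Schwarz_ineq2[of v \<xi>], of 2] by simp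
  also have "\<dots> \<le> (norm v)\<^sup>2 * (1 + (norm \<xi>)\<^sup>2)"
    by (simp add: power_mult_distrib distrib_left)
  finally show "\<bar>(v \<bullet> \<xi>)\<^sup>2\<bar> \<le> (norm v)\<^sup>2 * (1 + (norm \<xi>)\<^sup>2)"
    by simp
qed simp

lemma integrable_cos_mult:
  fixes f g :: "'a \<Rightarrow> real"
  assumes [measurable]: "g \<in> borel_measurable N" and f: "integrable N f"
  shows "integrable N (\<lambda>x. cos (g x) * f x)"
proof -
  note [measurable] = borel_measurable_integrable[OF f]
  show ?thesis
    by (rule Bochner_Integration.integrable_bound[OF f], measurable, intro AE_I2)
      (simp add: abs_mult mult_left_le_one_le)
qed

text \<open>The left-hand side is a second directional derivative of a Gaussian, hence a limit of second differences.\<close>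

lemma abs_integral_cos_square_le:
  fixes y v :: "real ^ 'n"
  assumes \<sigma>: "0 < \<sigma>"
  shows "\<bar>LINT \<xi>|std_gaussian. cos (y \<bullet> (\<xi> /\<^sub>R \<sigma>)) * (v \<bullet> (\<xi> /\<^sub>R \<sigma>))\<^sup>2\<bar>
    \<le> 32 * (norm v)\<^sup>2 / \<sigma>\<^sup>2 * exp (- (norm y)\<^sup>2 / (4 * \<sigma>\<^sup>2))"
proof -
  \<comment> \<open>2 N^2 (1 - cos (a / N)) tends to a^2 and never exceeds it, so \<open>s n\<close>
    approximates the integrand under a dominating function. By the product-to-sum formula
    \<open>s n\<close> integrates to a second difference of the Gaussian.\<close>
  define s where "s n \<xi> = cos (y \<bullet> (\<xi> /\<^sub>R \<sigma>)) * (2 * (real (Suc n))\<^sup>2 * (1 - cos ((v \<bullet> (\<xi> /\<^sub>R \<sigma>)) / real (Suc n))))"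
    for n and \<xi> :: "real ^ 'n"
  have [measurable]: "s n \<in> borel_measurable std_gaussian" for n
    unfolding s_def by measurable
  note int = integrable_std_gaussian_inner_square[of v \<sigma>]
  have lim: "(\<lambda>n. LINT \<xi>|std_gaussian. s n \<xi>) \<longlonglongrightarrow> (LINT \<xi>|std_gaussian. cos (y \<bullet> (\<xi> /\<^sub>R \<sigma>)) * (v \<bullet> (\<xi> /\<^sub>R \<sigma>))\<^sup>2)"
  proof (rule integral_dominated_convergence[OF _ _ int])
    show "AE \<xi> in std_gaussian. (\<lambda>n. s n \<xi>) \<longlonglongrightarrow> cos (y \<bullet> (\<xi> /\<^sub>R \<sigma>)) * (v \<bullet> (\<xi> /\<^sub>R \<sigma>))\<^sup>2"
    proof (intro AE_I2)
      fix \<xi> :: "real ^ 'n"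
      have lim2: "(\<lambda>n. 2 * (real (Suc n))\<^sup>2 * (1 - cos (a / real (Suc n)))) \<longlonglongrightarrow> a\<^sup>2" for a :: real
      proof -
        have "(\<lambda>n. 2 * (real (Suc n))\<^sup>2 * (1 - cos (a / real (Suc n)))) \<longlonglongrightarrow> a * a"
          by real_asymp
        then show ?thesis
          unfolding power2_eq_square[of a] .
      qed
      show "(\<lambda>n. s n \<xi>) \<longlonglongrightarrow> cos (y \<bullet> (\<xi> /\<^sub>R \<sigma>)) * (v \<bullet> (\<xi> /\<^sub>R \<sigma>))\<^sup>2"
        unfolding s_def by (rule tendsto_mult[OF tendsto_const lim2])
    qed
    show "AE \<xi> in std_gaussian. norm (s n \<xi>) \<le> (v \<bullet> (\<xi> /\<^sub>R \<sigma>))\<^sup>2" for n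
    proof (intro AE_I2)
      fix \<xi> :: "real ^ 'n"
      define a where "a = v \<bullet> (\<xi> /\<^sub>R \<sigma>)"
      have "\<bar>s n \<xi>\<bar> = \<bar>cos (y \<bullet> (\<xi> /\<^sub>R \<sigma>))\<bar> * (2 * (real (Suc n))\<^sup>2 * (1 - cos (a / real (Suc n))))"
        by (simp add: s_def a_def abs_mult)
      also have "\<dots> \<le> 1 * (2 * (real (Suc n))\<^sup>2 * ((a / real (Suc n))\<^sup>2 / 2))"
        by (intro mult_mono one_minus_cos_le) auto
      also have "\<dots> = a\<^sup>2"
        by (simp add: power2_eq_square)
      finally show "norm (s n \<xi>) \<le> (v \<bullet> (\<xi> /\<^sub>R \<sigma>))\<^sup>2"
        by (simp add: a_def)
    qed
  qed measurable
  have val: "(LINT \<xi>|std_gaussian. s n \<xi>) = - 2 * (real (Suc n))\<^sup>2 * second_diff (gauss \<sigma>) (v /\<^sub>R real (Suc n)) y" for n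
  proof -
    define w where "w = v /\<^sub>R real (Suc n)"
    have c: "integrable std_gaussian (\<lambda>\<xi> :: real ^ 'n. cos (x \<bullet> (\<xi> /\<^sub>R \<sigma>)))" for x
      by (intro std_gaussian.integrable_const_bound[where B = 1]) auto
    have "s n \<xi> = - (real (Suc n))\<^sup>2 * (cos ((y + w) \<bullet> (\<xi> /\<^sub>R \<sigma>)) + cos ((y - w) \<bullet> (\<xi> /\<^sub>R \<sigma>)) - 2 * cos (y \<bullet> (\<xi> /\<^sub>R \<sigma>)))" for \<xi>
    proof -
      have "(v \<bullet> (\<xi> /\<^sub>R \<sigma>)) / real (Suc n) = w \<bullet> (\<xi> /\<^sub>R \<sigma>)"
        by (simp add: w_def field_simps)
      then show ?thesis
        unfolding s_def by (simp add: inner_add_left inner_diff_left cos_add cos_diff algebra_simps)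
    qed
    then have "(LINT \<xi>|std_gaussian. s n \<xi>) = - (real (Suc n))\<^sup>2 *
        (gauss \<sigma> (y + w) + gauss \<sigma> (y - w) - 2 * gauss \<sigma> y)"
      using c by (simp add: gauss_fourier[OF \<sigma>, symmetric])
    then show ?thesis
      by (simp add: second_diff_def w_def)
  qed
  have "\<forall>\<^sub>F n in sequentially. \<bar>LINT \<xi>|std_gaussian. s n \<xi>\<bar>
      \<le> 32 * (norm v)\<^sup>2 / \<sigma>\<^sup>2 * exp (- (norm y)\<^sup>2 / (4 * \<sigma>\<^sup>2))"
  proof -
    \<comment> \<open>For large n the rescaled step v / N is short enough for
      \<open>abs_second_diff_gauss_le\<close>, and the factor N^2 cancels.\<close>
    have "(\<lambda>n. norm v / real (Suc n)) \<longlonglongrightarrow> 0"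
      by real_asymp
    then have "\<forall>\<^sub>F n in sequentially. norm v / real (Suc n) < \<sigma> / 8"
      using \<sigma> by (intro order_tendstoD(2)) auto
    then show ?thesis
    proof eventually_elim
      case (elim n)
      define N where "N = real (Suc n)"
      define E where "E = exp (- (norm y)\<^sup>2 / (4 * \<sigma>\<^sup>2))"
      have N: "0 < N"
        by (simp add: N_def)
      have vN: "norm (v /\<^sub>R N) = norm v / N"
        using N by (simp add: divide_inverse mult.commute)
      have "norm (v /\<^sub>R N) \<le> max (norm y) \<sigma> / 8"
        unfolding vN using elim by (simp add: N_def)
      from abs_second_diff_gauss_le[OF \<sigma> this]
      have "\<bar>second_diff (gauss \<sigma>) (v /\<^sub>R N) y\<bar> \<le> 16 * ((norm v / N)\<^sup>2 / \<sigma>\<^sup>2) * E"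
        unfolding vN E_def .
      then have "2 * N\<^sup>2 * \<bar>second_diff (gauss \<sigma>) (v /\<^sub>R N) y\<bar> \<le> 2 * N\<^sup>2 * (16 * ((norm v / N)\<^sup>2 / \<sigma>\<^sup>2) * E)"
        by (intro mult_left_mono) auto
      also have "\<dots> = 32 * (norm v)\<^sup>2 / \<sigma>\<^sup>2 * E"
        using N by (simp add: power_divide)
      also have "2 * N\<^sup>2 * \<bar>second_diff (gauss \<sigma>) (v /\<^sub>R N) y\<bar> = \<bar>LINT \<xi>|std_gaussian. s n \<xi>\<bar>"
        unfolding val N_def[symmetric] by (simp add: abs_mult)
      finally show ?case
        unfolding E_def .
    qed
  qed
  then show ?thesis
    by (rule tendsto_upperbound[OF tendsto_rabs[OF lim]]) simp
qed

text \<open>Polarization; the signs of the coefficients are irrelevant because the directional bounds are two-sided.\<close>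

lemma abs_integral_cos_quadratic_form_le:
  fixes B :: "real ^ 'n ^ 'n" and y :: "real ^ 'n"
  assumes \<sigma>: "0 < \<sigma>"
  shows "\<bar>LINT \<xi>|std_gaussian. cos (y \<bullet> (\<xi> /\<^sub>R \<sigma>)) * ((B *v (\<xi> /\<^sub>R \<sigma>)) \<bullet> (\<xi> /\<^sub>R \<sigma>))\<bar>
    \<le> 64 * (\<Sum>i\<in>UNIV. \<Sum>j\<in>UNIV. \<bar>B $ i $ j\<bar>) / \<sigma>\<^sup>2 * exp (- (norm y)\<^sup>2 / (4 * \<sigma>\<^sup>2))"
proof -
  define E where "E = exp (- (norm y)\<^sup>2 / (4 * \<sigma>\<^sup>2)) / \<sigma>\<^sup>2"
  define Q where "Q v \<xi> = cos (y \<bullet> (\<xi> /\<^sub>R \<sigma>)) * (v \<bullet> (\<xi> /\<^sub>R \<sigma>))\<^sup>2" for v \<xi> :: "real ^ 'n"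
  have intQ: "integrable std_gaussian (Q v)" for v
    unfolding Q_def by (intro integrable_cos_mult integrable_std_gaussian_inner_square) simp
  \<comment> \<open>The directions used are sums and differences of two unit vectors, hence of norm
    at most 2.\<close>
  have Q_le: "\<bar>LINT \<xi>|std_gaussian. Q v \<xi>\<bar> \<le> 128 * E" if "norm v \<le> 2" for v
  proof -
    have "\<bar>LINT \<xi>|std_gaussian. Q v \<xi>\<bar> \<le> 32 * (norm v)\<^sup>2 * E"
      using abs_integral_cos_square_le[OF \<sigma>, of y v] by (simp add: Q_def E_def)
    also have "\<dots> \<le> 32 * 4 * E"
      using power_mono[OF that, of 2] by (intro mult_right_mono) (auto simp: E_def)
    finally show ?thesis
      by simp
  qed
  have eq: "cos (y \<bullet> (\<xi> /\<^sub>R \<sigma>)) * ((B *v (\<xi> /\<^sub>R \<sigma>)) \<bullet> (\<xi> /\<^sub>R \<sigma>))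
      = (\<Sum>i\<in>UNIV. \<Sum>j\<in>UNIV. B $ i $ j / 4 * (Q (axis i 1 + axis j 1) \<xi> - Q (axis i 1 - axis j 1) \<xi>))" for \<xi>
  proof -
    define \<zeta> where "\<zeta> = \<xi> /\<^sub>R \<sigma>"
    have "(B *v \<zeta>) \<bullet> \<zeta> = (\<Sum>i\<in>UNIV. \<Sum>j\<in>UNIV. B $ i $ j * (\<zeta> $ i * \<zeta> $ j))"
      by (simp add: inner_vec_def matrix_vector_mult_def sum_distrib_right sum_distrib_left algebra_simps)
    also have "\<dots> = (\<Sum>i\<in>UNIV. \<Sum>j\<in>UNIV. B $ i $ j / 4 *
        (((axis i 1 + axis j 1) \<bullet> \<zeta>)\<^sup>2 - ((axis i 1 - axis j 1) \<bullet> \<zeta>)\<^sup>2))"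
      by (intro sum.cong refl)
        (simp add: inner_add_left inner_diff_left inner_axis' power2_eq_square algebra_simps)
    finally show ?thesis
      unfolding Q_def \<zeta>_def[symmetric] by (simp add: sum_distrib_left algebra_simps)
  qed
  have "(LINT \<xi>|std_gaussian. cos (y \<bullet> (\<xi> /\<^sub>R \<sigma>)) * ((B *v (\<xi> /\<^sub>R \<sigma>)) \<bullet> (\<xi> /\<^sub>R \<sigma>)))
      = (\<Sum>i\<in>UNIV. \<Sum>j\<in>UNIV. B $ i $ j / 4 *
          ((LINT \<xi>|std_gaussian. Q (axis i 1 + axis j 1) \<xi>) - (LINT \<xi>|std_gaussian. Q (axis i 1 - axis j 1) \<xi>)))"
    unfolding eq using intQ by simp
  also have "\<bar>\<dots>\<bar> \<le> (\<Sum>i\<in>UNIV. \<Sum>j\<in>UNIV. \<bar>B $ i $ j\<bar> * (64 * E))"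
  proof (intro order_trans[OF sum_abs] sum_mono)
    fix i j :: 'n
    have 1: "\<bar>LINT \<xi>|std_gaussian. Q (axis i 1 + axis j 1) \<xi>\<bar> \<le> 128 * E"
      using norm_triangle_ineq[of "axis i (1::real)" "axis j 1"] by (intro Q_le) simp
    have 2: "\<bar>LINT \<xi>|std_gaussian. Q (axis i 1 - axis j 1) \<xi>\<bar> \<le> 128 * E"
      using norm_triangle_ineq4[of "axis i (1::real)" "axis j 1"] by (intro Q_le) simp
    have "\<bar>B $ i $ j / 4 *
          ((LINT \<xi>|std_gaussian. Q (axis i 1 + axis j 1) \<xi>) - (LINT \<xi>|std_gaussian. Q (axis i 1 - axis j 1) \<xi>))\<bar>
        \<le> \<bar>B $ i $ j\<bar> / 4 * (256 * E)"
      unfolding abs_mult using 1 2 by (intro mult_mono) auto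
    then show "\<bar>B $ i $ j / 4 *
          ((LINT \<xi>|std_gaussian. Q (axis i 1 + axis j 1) \<xi>) - (LINT \<xi>|std_gaussian. Q (axis i 1 - axis j 1) \<xi>))\<bar>
        \<le> \<bar>B $ i $ j\<bar> * (64 * E)"
      by (simp add: mult_ac)
  qed
  also have "\<dots> = 64 * (\<Sum>i\<in>UNIV. \<Sum>j\<in>UNIV. \<bar>B $ i $ j\<bar>) * E"
    by (simp add: sum_distrib_left sum_distrib_right algebra_simps)
  finally show ?thesis
    by (simp add: E_def)
qed

section \<open>Short-time expansion on Gaussians, and the generator as an integral of second
  differences\<close>

context symmetric_levy_process
begin

text \<open>The generator of \<open>X\<close> applied to \<open>gauss \<sigma>\<close>, as a Fourier multiplier.\<close>

definition gen :: "real \<Rightarrow> real ^ 'n \<Rightarrow> real" where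
  "gen \<sigma> y = - (LINT \<xi>|std_gaussian. cos (y \<bullet> (\<xi> /\<^sub>R \<sigma>)) * \<psi> (\<xi> /\<^sub>R \<sigma>))"

lemma integrable_levy_exponent_std_gaussian:
  "integrable std_gaussian (\<lambda>\<xi>. \<psi> (\<xi> /\<^sub>R \<sigma>))" "integrable std_gaussian (\<lambda>\<xi>. (\<psi> (\<xi> /\<^sub>R \<sigma>))\<^sup>2)"
proof -
  obtain C where "\<And>\<xi>. \<psi> \<xi> \<le> C * (1 + (norm \<xi>)\<^sup>2)"
    using levy_exponent_le by blast
  then have "\<bar>\<psi> \<xi>\<bar> \<le> C * (1 + (norm \<xi>)\<^sup>2)" for \<xi>
    using levy_exponent_nonneg[of \<xi>] by simp
  then show "integrable std_gaussian (\<lambda>\<xi>. \<psi> (\<xi> /\<^sub>R \<sigma>))" "integrable std_gaussian (\<lambda>\<xi>. (\<psi> (\<xi> /\<^sub>R \<sigma>))\<^sup>2)"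
    by (auto intro!: integrable_std_gaussian_quadratic[where C = C])
qed

lemma expectation_gauss:
  assumes \<sigma>: "0 < \<sigma>" and h: "0 \<le> h"
  shows "expectation (\<lambda>\<omega>. gauss \<sigma> (y + X h \<omega>)) =
    (LINT \<xi>|std_gaussian. cos (y \<bullet> (\<xi> /\<^sub>R \<sigma>)) * exp (- h * \<psi> (\<xi> /\<^sub>R \<sigma>)))"
proof -
  note [measurable] = measurable_X[OF h]
  interpret P: pair_prob_space M "std_gaussian :: (real ^ 'n) measure" ..
  have int: "integrable (M \<Otimes>\<^sub>M std_gaussian) (\<lambda>(\<omega>, \<xi>). cos ((y + X h \<omega>) \<bullet> (\<xi> /\<^sub>R \<sigma>)))"
    by (intro P.integrable_const_bound[where B = 1]) auto
  have "expectation (\<lambda>\<omega>. gauss \<sigma> (y + X h \<omega>))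
      = expectation (\<lambda>\<omega>. LINT \<xi>|std_gaussian. cos ((y + X h \<omega>) \<bullet> (\<xi> /\<^sub>R \<sigma>)))"
    by (simp add: gauss_fourier[OF \<sigma>] del: inner_scaleR_right)
  also have "\<dots> = (LINT \<xi>|std_gaussian. expectation (\<lambda>\<omega>. cos ((y + X h \<omega>) \<bullet> (\<xi> /\<^sub>R \<sigma>))))"
    by (rule P.Fubini_integral[OF int, symmetric])
  finally show ?thesis
    by (simp add: expectation_cos_increment[OF h] del: inner_scaleR_right)
qed

text \<open>Linearise exp (- h \<psi>) inside the Fourier integral. The remainder is estimated with
  |cos| <= 1, hence uniformly in y; this later allows one step size for all starting points.\<close>

lemma expectation_gauss_le:
  assumes \<sigma>: "0 < \<sigma>" and h: "0 \<le> h"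
  shows "expectation (\<lambda>\<omega>. gauss \<sigma> (y + X h \<omega>))
    \<le> gauss \<sigma> y + h * gen \<sigma> y + h\<^sup>2 * (2 * (LINT \<xi>|std_gaussian. (\<psi> (\<xi> /\<^sub>R \<sigma>))\<^sup>2))"
proof -
  note int = integrable_levy_exponent_std_gaussian[of \<sigma>]
  have c: "integrable std_gaussian (\<lambda>\<xi> :: real ^ 'n. cos (y \<bullet> (\<xi> /\<^sub>R \<sigma>)))"
    by (intro std_gaussian.integrable_const_bound[where B = 1]) auto
  have c\<psi>: "integrable std_gaussian (\<lambda>\<xi> :: real ^ 'n. cos (y \<bullet> (\<xi> /\<^sub>R \<sigma>)) * \<psi> (\<xi> /\<^sub>R \<sigma>))"
    by (intro integrable_cos_mult int) simp
  have "expectation (\<lambda>\<omega>. gauss \<sigma> (y + X h \<omega>)) \<le>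
      (LINT \<xi>|std_gaussian. cos (y \<bullet> (\<xi> /\<^sub>R \<sigma>)) - h * (cos (y \<bullet> (\<xi> /\<^sub>R \<sigma>)) * \<psi> (\<xi> /\<^sub>R \<sigma>))
        + h\<^sup>2 * (2 * (\<psi> (\<xi> /\<^sub>R \<sigma>))\<^sup>2))"
    unfolding expectation_gauss[OF assms]
  proof (rule integral_mono)
    show "integrable std_gaussian (\<lambda>\<xi>. cos (y \<bullet> (\<xi> /\<^sub>R \<sigma>)) * exp (- h * \<psi> (\<xi> /\<^sub>R \<sigma>)))"
      using h by (intro integrable_cos_mult std_gaussian.integrable_const_bound[where B = 1])
        (auto simp: levy_exponent_nonneg)
    show "integrable std_gaussian (\<lambda>\<xi>. cos (y \<bullet> (\<xi> /\<^sub>R \<sigma>)) - h * (cos (y \<bullet> (\<xi> /\<^sub>R \<sigma>)) * \<psi> (\<xi> /\<^sub>R \<sigma>))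
        + h\<^sup>2 * (2 * (\<psi> (\<xi> /\<^sub>R \<sigma>))\<^sup>2))"
      by (intro Bochner_Integration.integrable_add Bochner_Integration.integrable_diff integrable_mult_right c c\<psi> int)
    fix \<xi> :: "real ^ 'n"
    define v where "v = h * \<psi> (\<xi> /\<^sub>R \<sigma>)"
    have v: "0 \<le> v"
      using h by (simp add: v_def levy_exponent_nonneg)
    have "cos (y \<bullet> (\<xi> /\<^sub>R \<sigma>)) * (exp (- v) - 1 + v) \<le> \<bar>cos (y \<bullet> (\<xi> /\<^sub>R \<sigma>))\<bar> * \<bar>exp (- v) - 1 + v\<bar>"
      by (simp add: abs_mult[symmetric] del: inner_scaleR_right)
    also have "\<dots> \<le> 1 * (2 * v\<^sup>2)"
      by (intro mult_mono exp_minus_le_quadratic v) auto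
    finally show "cos (y \<bullet> (\<xi> /\<^sub>R \<sigma>)) * exp (- h * \<psi> (\<xi> /\<^sub>R \<sigma>))
        \<le> cos (y \<bullet> (\<xi> /\<^sub>R \<sigma>)) - h * (cos (y \<bullet> (\<xi> /\<^sub>R \<sigma>)) * \<psi> (\<xi> /\<^sub>R \<sigma>)) + h\<^sup>2 * (2 * (\<psi> (\<xi> /\<^sub>R \<sigma>))\<^sup>2)"
      by (simp add: v_def power_mult_distrib algebra_simps del: inner_scaleR_right)
  qed
  also have "\<dots> = gauss \<sigma> y + h * gen \<sigma> y + h\<^sup>2 * (2 * (LINT \<xi>|std_gaussian. (\<psi> (\<xi> /\<^sub>R \<sigma>))\<^sup>2))"
    using c c\<psi> int by (simp add: gen_def gauss_fourier[OF \<sigma>] del: inner_scaleR_right)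
  finally show ?thesis .
qed

text \<open>Fubini for the frequency law and the jump density: averaging cos (y \<bullet> \<xi>)
  (cos (\<xi> \<bullet> z) - 1), with \<xi> rescaled by \<sigma>, over the frequencies gives the
  second difference of the Gaussian in direction z.\<close>

lemma integrable_\<nu>_second_diff_gauss:
  assumes \<sigma>: "0 < \<sigma>"
  shows "integrable lborel (\<lambda>z. \<nu> z * second_diff (gauss \<sigma>) z y)"
    and gen_eq: "gen \<sigma> y = - (LINT \<xi>|std_gaussian. cos (y \<bullet> (\<xi> /\<^sub>R \<sigma>)) * ((A *v (\<xi> /\<^sub>R \<sigma>)) \<bullet> (\<xi> /\<^sub>R \<sigma>)))
      + (LINT z|lborel. \<nu> z * second_diff (gauss \<sigma>) z y)"
proof -
  note [measurable] = measurable_\<nu>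
  interpret P: pair_sigma_finite "std_gaussian :: (real ^ 'n) measure" "lborel :: (real ^ 'n) measure" ..
  define f where "f \<xi> z = cos (y \<bullet> (\<xi> /\<^sub>R \<sigma>)) * (\<nu> z * (cos ((\<xi> /\<^sub>R \<sigma>) \<bullet> z) - 1))" for \<xi> z
  \<comment> \<open>With the absolute value the domination holds at every z, also at 0, where the
    sign of \<nu> is unspecified.\<close>
  define b where "b \<xi> z = (2 + (norm (\<xi> /\<^sub>R \<sigma>))\<^sup>2) * (\<bar>\<nu> z\<bar> * min 1 ((norm z)\<^sup>2))" for \<xi> z :: "real ^ 'n"
  have int2: "integrable std_gaussian (\<lambda>\<xi> :: real ^ 'n. 2 + (norm (\<xi> /\<^sub>R \<sigma>))\<^sup>2)"
    by (rule integrable_std_gaussian_quadratic(1)[where f = "\<lambda>\<xi>. 2 + (norm \<xi>)\<^sup>2" and C = 2]) auto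
  have int\<nu>: "integrable lborel (\<lambda>z. \<bar>\<nu> z\<bar> * min 1 ((norm z)\<^sup>2))"
    using integrable_norm[OF integrable_\<nu>_min] by (simp add: abs_mult)
  have intb: "integrable (std_gaussian \<Otimes>\<^sub>M lborel) (case_prod b)"
  proof (rule P.Fubini_integrable)
    show "case_prod b \<in> borel_measurable (std_gaussian \<Otimes>\<^sub>M lborel)"
      unfolding b_def by measurable
    show "AE \<xi> in std_gaussian. integrable lborel (\<lambda>z. case_prod b (\<xi>, z))"
      unfolding b_def using int\<nu> by auto
    show "integrable std_gaussian (\<lambda>\<xi>. LINT z|lborel. norm (case_prod b (\<xi>, z)))"
      unfolding b_def using int2 by (auto simp: abs_mult)
  qed
  have intf: "integrable (std_gaussian \<Otimes>\<^sub>M lborel) (case_prod f)"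
  proof (rule Bochner_Integration.integrable_bound[OF intb])
    show "case_prod f \<in> borel_measurable (std_gaussian \<Otimes>\<^sub>M lborel)"
      unfolding f_def by measurable
    have "norm (f \<xi> z) \<le> norm (b \<xi> z)" for \<xi> z
    proof -
      have "norm (f \<xi> z) = \<bar>cos (y \<bullet> (\<xi> /\<^sub>R \<sigma>))\<bar> * (\<bar>\<nu> z\<bar> * (1 - cos ((\<xi> /\<^sub>R \<sigma>) \<bullet> z)))"
        by (simp add: f_def abs_mult)
      also have "\<dots> \<le> 1 * (\<bar>\<nu> z\<bar> * ((2 + (norm (\<xi> /\<^sub>R \<sigma>))\<^sup>2) * min 1 ((norm z)\<^sup>2)))"
        by (intro mult_mono mult_left_mono one_minus_cos_inner_le) auto
      also have "\<dots> \<le> norm (b \<xi> z)"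
        unfolding b_def by (simp add: abs_mult algebra_simps)
      finally show ?thesis .
    qed
    then show "AE x in std_gaussian \<Otimes>\<^sub>M lborel. norm (case_prod f x) \<le> norm (case_prod b x)"
      by auto
  qed
  have sd: "(LINT \<xi>|std_gaussian. f \<xi> z) = \<nu> z * second_diff (gauss \<sigma>) z y" for z
  proof -
    have c: "integrable std_gaussian (\<lambda>\<xi> :: real ^ 'n. cos (x \<bullet> (\<xi> /\<^sub>R \<sigma>)))" for x
      by (intro std_gaussian.integrable_const_bound[where B = 1]) auto
    have "f \<xi> z = \<nu> z * ((cos ((y + z) \<bullet> (\<xi> /\<^sub>R \<sigma>)) + cos ((y - z) \<bullet> (\<xi> /\<^sub>R \<sigma>))) / 2 - cos (y \<bullet> (\<xi> /\<^sub>R \<sigma>)))" for \<xi>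
      unfolding f_def
      by (simp add: inner_add_left inner_diff_left cos_add cos_diff algebra_simps inner_commute[of _ z]
          del: inner_scaleR_right inner_scaleR_left)
    then have "(LINT \<xi>|std_gaussian. f \<xi> z) = \<nu> z * ((gauss \<sigma> (y + z) + gauss \<sigma> (y - z)) / 2 - gauss \<sigma> y)"
      using c by (simp add: gauss_fourier[OF \<sigma>, symmetric] del: inner_scaleR_right)
    then show ?thesis
      by (simp add: second_diff_def)
  qed
  show "integrable lborel (\<lambda>z. \<nu> z * second_diff (gauss \<sigma>) z y)"
    using P.integrable_snd[OF intf] by (simp add: sd)
  have fub: "(LINT z|lborel. \<nu> z * second_diff (gauss \<sigma>) z y) = (LINT \<xi>|std_gaussian. LINT z|lborel. f \<xi> z)"
    using P.Fubini_integral[OF intf] by (simp add: sd)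
  have split: "cos (y \<bullet> (\<xi> /\<^sub>R \<sigma>)) * \<psi> (\<xi> /\<^sub>R \<sigma>)
      = cos (y \<bullet> (\<xi> /\<^sub>R \<sigma>)) * ((A *v (\<xi> /\<^sub>R \<sigma>)) \<bullet> (\<xi> /\<^sub>R \<sigma>)) - (LINT z|lborel. f \<xi> z)" for \<xi>
  proof -
    have "f \<xi> z = - cos (y \<bullet> (\<xi> /\<^sub>R \<sigma>)) * (\<nu> z * (1 - cos ((\<xi> /\<^sub>R \<sigma>) \<bullet> z)))" for z
      unfolding f_def by (simp add: algebra_simps del: inner_scaleR_right inner_scaleR_left)
    then have "(LINT z|lborel. f \<xi> z)
        = - (cos (y \<bullet> (\<xi> /\<^sub>R \<sigma>)) * (LINT z|lborel. \<nu> z * (1 - cos ((\<xi> /\<^sub>R \<sigma>) \<bullet> z))))"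
      by (simp del: inner_scaleR_right inner_scaleR_left)
    then show ?thesis
      unfolding levy_exponent_eq by (simp add: distrib_left)
  qed
  have quad: "integrable std_gaussian (\<lambda>\<xi>. cos (y \<bullet> (\<xi> /\<^sub>R \<sigma>)) * ((A *v (\<xi> /\<^sub>R \<sigma>)) \<bullet> (\<xi> /\<^sub>R \<sigma>)))"
  proof (intro integrable_cos_mult)
    have "\<bar>(A *v \<xi>) \<bullet> \<xi>\<bar> \<le> (\<Sum>i\<in>UNIV. \<Sum>j\<in>UNIV. \<bar>A $ i $ j\<bar>) * (1 + (norm \<xi>)\<^sup>2)" for \<xi>
      using abs_quadratic_form_le[of A \<xi>] by (simp add: distrib_left sum_nonneg add_increasing)
    then show "integrable std_gaussian (\<lambda>\<xi>. (A *v (\<xi> /\<^sub>R \<sigma>)) \<bullet> (\<xi> /\<^sub>R \<sigma>))"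
      by (intro integrable_std_gaussian_quadratic(1)[where f = "\<lambda>\<xi>. (A *v \<xi>) \<bullet> \<xi>"])
        (auto intro!: borel_measurable_continuous_onI continuous_intros)
  qed simp
  show "gen \<sigma> y = - (LINT \<xi>|std_gaussian. cos (y \<bullet> (\<xi> /\<^sub>R \<sigma>)) * ((A *v (\<xi> /\<^sub>R \<sigma>)) \<bullet> (\<xi> /\<^sub>R \<sigma>)))
      + (LINT z|lborel. \<nu> z * second_diff (gauss \<sigma>) z y)"
    unfolding gen_def split fub
    by (subst Bochner_Integration.integral_diff[OF quad]) (use P.integrable_fst[OF intf] in simp_all)
qed

end

section \<open>Gaussian mixtures comparable with a doubling function\<close>

text \<open>Trades exponential decay for decay of any prescribed power, through (1 + v / p)^p <= exp
  v.\<close>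

lemma exp_minus_le_power:
  fixes v :: real
  assumes "0 < v" "0 < p"
  shows "exp (- v) \<le> (real p / v) ^ p"
proof -
  have "(v / real p) ^ p \<le> (1 + v / real p) ^ p"
    using assms by (intro power_mono) auto
  also have "\<dots> \<le> exp v"
    using assms by (intro exp_ge_one_plus_x_over_n_power_n) auto
  finally have "inverse (exp v) \<le> inverse ((v / real p) ^ p)"
    using assms by (intro le_imp_inverse_le) auto
  then show ?thesis
    by (simp add: exp_minus power_divide)
qed

locale doubling_profile =
  fixes g :: "real \<Rightarrow> real" and K :: real
  assumes g_pos: "\<And>u. 0 < u \<Longrightarrow> 0 < g u"
    and g_antimono: "\<And>u v. 0 < u \<Longrightarrow> u \<le> v \<Longrightarrow> g v \<le> g u"
    and doubling: "\<And>s. 1 \<le> s \<Longrightarrow> g s \<le> K * g (2 * s)"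
begin

definition dyadic :: "real \<Rightarrow> nat \<Rightarrow> real" where
  "dyadic R k = 2 ^ k * R"

text \<open>The weights telescope: for j <= n those with index from j to n - 1, together with the
  leftover \<open>g (dyadic R n)\<close>, add up to \<open>g (dyadic R j)\<close>.\<close>

definition weight :: "real \<Rightarrow> nat \<Rightarrow> real" where
  "weight R k = g (dyadic R k) - g (dyadic R (Suc k))"

text \<open>The leftover mass \<open>g (dyadic R n)\<close> of the truncated mixture is put on the constant function. This keeps
  the sums finite and \<open>mixture\<close> bounded away from \<open>0\<close>, so that errors of second order in time can
  be absorbed into it.\<close>

definition mixture :: "real \<Rightarrow> nat \<Rightarrow> 'a::real_inner \<Rightarrow> real" where
  "mixture R n y = g (dyadic R n) + (\<Sum>k<n. weight R k * gauss (dyadic R k) y)"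

lemma K_ge_1: "1 \<le> K"
proof -
  have "g 1 \<le> K * g 2" "g 2 \<le> g 1" "0 < g 2"
    using doubling[of 1] g_antimono[of 1 2] g_pos[of 2] by auto
  then have "1 * g 2 \<le> K * g 2"
    by linarith
  then show ?thesis
    using \<open>0 < g 2\<close> by (rule mult_right_le_imp_le)
qed

lemma dyadic_Suc: "dyadic R (Suc k) = 2 * dyadic R k"
  by (simp add: dyadic_def)

lemma dyadic_0: "dyadic R 0 = R"
  by (simp add: dyadic_def)

lemma dyadic_ge: "0 \<le> R \<Longrightarrow> R \<le> dyadic R k"
  unfolding dyadic_def using one_le_power[of "2 :: real" k] mult_right_mono[of 1 "2 ^ k" R] by simp

lemma dyadic_pos: "0 < R \<Longrightarrow> 0 < dyadic R k"
  by (simp add: dyadic_def)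

lemma weight_nonneg: "0 < R \<Longrightarrow> 0 \<le> weight R k"
  unfolding weight_def dyadic_Suc using g_antimono[of "dyadic R k" "2 * dyadic R k"] dyadic_pos[of R k] by simp

lemma weight_le: "0 < R \<Longrightarrow> weight R k \<le> g (dyadic R k)"
  unfolding weight_def using g_pos[of "dyadic R (Suc k)"] dyadic_pos[of R "Suc k"] by simp

lemma g_dyadic_le_mixture: "0 < R \<Longrightarrow> g (dyadic R n) \<le> mixture R n y"
  unfolding mixture_def by (simp add: sum_nonneg weight_nonneg gauss_pos less_imp_le)

lemma mixture_pos: "0 < R \<Longrightarrow> 0 < mixture R n y"
  using g_dyadic_le_mixture[of R n y] g_pos[OF dyadic_pos[of R n]] by simp

lemma dyadic_unbounded:
  assumes "0 < R"
  shows "\<exists>n. q \<le> dyadic R n"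
proof -
  obtain n where "q / R < 2 ^ n"
    using real_arch_pow[of 2 "q / R"] by auto
  then show ?thesis
    using assms by (intro exI[of _ n]) (simp add: dyadic_def field_simps)
qed

text \<open>At scales at least q = max |y| R the Gaussians are at least exp (- 1 / 2). Their weights
  and the leftover telescope to g at the first such scale, which is at most 2 q.\<close>

lemma mixture_lower:
  assumes R: "0 < R"
  shows "exp (- 1 / 2) * g (2 * max (norm y) R) \<le> mixture R n y"
proof -
  define q where "q = max (norm y) R"
  have q: "0 < q" "norm y \<le> q" "R \<le> q"
    using R by (auto simp: q_def)
  \<comment> \<open>Stronger than the claim: the leftover carries the same factor exp (- 1 / 2) as
    the Gaussian terms, so that the induction telescopes.\<close>
  have "exp (- 1 / 2) * g (2 * q) \<le> exp (- 1 / 2) * g (dyadic R n) + (\<Sum>k<n. weight R k * gauss (dyadic R k) y)"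
  proof (induction n)
    case 0
    then show ?case
      using q R g_antimono[of R "2 * q"] by (simp add: dyadic_0)
  next
    case (Suc m)
    show ?case
    proof (cases "q \<le> dyadic R m")
      case True
      have "norm y \<le> dyadic R m"
        using True q by simp
      then have "(norm y)\<^sup>2 / (2 * (dyadic R m)\<^sup>2) \<le> 1 / 2"
        using power_mono[of "norm y" "dyadic R m" 2] dyadic_pos[OF R, of m] by (simp add: field_simps)
      then have "weight R m * exp (- 1 / 2) \<le> weight R m * gauss (dyadic R m) y"
        using weight_nonneg[OF R] by (intro mult_left_mono) (simp_all add: gauss_def)
      then show ?thesis
        using Suc.IH by (simp add: weight_def algebra_simps)
    next
      case False
      \<comment> \<open>Here the next scale is still below 2 q, so the leftover alone
        suffices.\<close>
      then have "g (2 * q) \<le> g (dyadic R (Suc m))"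
        using dyadic_pos[OF R, of m] by (intro g_antimono) (auto simp: dyadic_Suc)
      then have "exp (- 1 / 2) * g (2 * q) \<le> exp (- 1 / 2) * g (dyadic R (Suc m))"
        by simp
      moreover have "0 \<le> (\<Sum>k<Suc m. weight R k * gauss (dyadic R k) y)"
        using weight_nonneg[OF R] by (intro sum_nonneg mult_nonneg_nonneg) (auto simp: gauss_pos less_imp_le)
      ultimately show ?thesis
        by linarith
    qed
  qed
  also have "exp (- 1 / 2) * g (dyadic R n) \<le> 1 * g (dyadic R n)"
    using g_pos[OF dyadic_pos[OF R, of n]] by (intro mult_right_mono) auto
  finally show ?thesis
    by (simp add: mixture_def q_def)
qed

text \<open>Scales above q = max |y| R contribute at most their telescoping weights. At scales below
  q the growth of g towards small arguments is only polynomial by doubling and is beaten by the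
  Gaussian decay, so the largest of these scales dominates. The doubled width is the one that the
  second difference estimates produce.\<close>

lemma gauss_mixture_upper:
  "\<exists>C\<ge>1. \<forall>R\<ge>1. \<forall>n. \<forall>y :: 'a::real_inner.
     g (dyadic R n) + (\<Sum>k<n. weight R k * gauss (2 * dyadic R k) y) \<le> C * g (min (dyadic R n) (max (norm y) R))"
proof -
  \<comment> \<open>This power makes g s (s / q)^(2 p) at least double from one dyadic scale to the
    next, since g loses at most a factor K.\<close>
  obtain p where p: "2 * K < 4 ^ p"
    using real_arch_pow[of 4 "2 * K"] by auto
  have p0: "0 < p"
    using p K_ge_1 by (cases p) auto
  define D :: real where "D = (8 * real p) ^ p"
  have D: "1 \<le> D"
    unfolding D_def using p0 by (intro one_le_power) simp
  define C where "C = D * 4 ^ p + 1"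
  have C: "1 \<le> C"
    using D by (simp add: C_def)
  have main: "g (dyadic R n) + (\<Sum>k<n. weight R k * gauss (2 * dyadic R k) y) \<le> C * g (min (dyadic R n) (max (norm y) R))"
    if R: "1 \<le> R" for R n and y :: 'a
  proof -
    define q where "q = max (norm y) R"
    have R0: "0 < R" and q: "0 < q" "norm y \<le> q" "R \<le> q"
      using R by (auto simp: q_def)
    \<comment> \<open>For |y| <= R every scale is at least q and the bound is trivial; otherwise q =
      |y| and the Gaussian decay is traded for the power 2 p.\<close>
    have decay: "gauss (2 * dyadic R k) y \<le> D * (dyadic R k / q) ^ (2 * p)" for k
    proof (cases "norm y \<le> R")
      case True
      then have "1 \<le> dyadic R k / q"
        using dyadic_ge[of R k] R0 by (simp add: q_def)
      then have "1 * 1 \<le> D * (dyadic R k / q) ^ (2 * p)"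
        using D by (intro mult_mono one_le_power) auto
      then show ?thesis
        using gauss_le_1[of "2 * dyadic R k" y] by simp
    next
      case False
      then have qy: "q = norm y"
        by (simp add: q_def)
      have s: "0 < dyadic R k"
        by (rule dyadic_pos[OF R0])
      have "gauss (2 * dyadic R k) y \<le> (real p / (q\<^sup>2 / (8 * (dyadic R k)\<^sup>2))) ^ p"
        unfolding gauss_two_mult qy[symmetric] minus_divide_left[symmetric]
        using q s p0 by (intro exp_minus_le_power) auto
      also have "real p / (q\<^sup>2 / (8 * (dyadic R k)\<^sup>2)) = (8 * real p) * (dyadic R k / q)\<^sup>2"
        by (simp add: power_divide)
      also have "\<dots> ^ p = D * (dyadic R k / q) ^ (2 * p)"
        by (simp add: D_def power_mult_distrib power_mult)
      finally show ?thesis .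
    qed
    have power4p: "(2 :: real) ^ (2 * p) = 4 ^ p"
      by (simp add: power_mult)
    \<comment> \<open>A nonnegative sequence that at least doubles at each step has partial sums
      bounded by the next term.\<close>
    have geom: "(\<Sum>k<n. g (dyadic R k) * (dyadic R k / q) ^ (2 * p)) \<le> g (dyadic R n) * (dyadic R n / q) ^ (2 * p)" for n
    proof (induction n)
      case 0
      then show ?case
        using g_pos[OF dyadic_pos[OF R0, of 0]] by simp
    next
      case (Suc m)
      define b where "b = (dyadic R m / q) ^ (2 * p)"
      have b: "0 \<le> b"
        by (simp add: b_def)
      have b4: "(dyadic R (Suc m) / q) ^ (2 * p) = 4 ^ p * b"
        by (simp add: b_def dyadic_Suc power_mult power_mult_distrib power_divide)
      have "2 * g (dyadic R m) \<le> 2 * (K * g (dyadic R (Suc m)))"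
        using doubling[of "dyadic R m"] dyadic_ge[of R m] R by (simp add: dyadic_Suc)
      also have "\<dots> \<le> 4 ^ p * g (dyadic R (Suc m))"
        using p g_pos[OF dyadic_pos[OF R0, of "Suc m"]] mult_right_mono[of "2 * K" "4 ^ p" "g (dyadic R (Suc m))"]
        by simp
      finally have "2 * g (dyadic R m) * b \<le> 4 ^ p * g (dyadic R (Suc m)) * b"
        using b by (rule mult_right_mono)
      then show ?case
        using Suc.IH unfolding b4 by (simp add: b_def algebra_simps)
    qed
    show ?thesis
      unfolding q_def[symmetric]
    proof (induction n)
      case 0
      then show ?case
        using q C g_pos[OF R0] mult_right_mono[of 1 C "g R"] by (simp add: dyadic_0 min_def)
    next
      case (Suc m)
      show ?case
      proof (cases "q \<le> dyadic R m")
        case True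
        \<comment> \<open>The new Gaussian is bounded by 1, and its weight is exactly what the
          leftover loses.\<close>
        then have "min (dyadic R (Suc m)) q = q" "min (dyadic R m) q = q"
          using q(1) by (auto simp: dyadic_Suc)
        moreover have "weight R m * gauss (2 * dyadic R m) y \<le> weight R m * 1"
          by (intro mult_left_mono gauss_le_1 weight_nonneg R0)
        ultimately show ?thesis
          using Suc.IH by (simp add: weight_def)
      next
        case False
        \<comment> \<open>All scales up to index m lie below q: the whole sum is estimated at once
          through \<open>geom\<close>, without the induction hypothesis.\<close>
        then have s2: "dyadic R (Suc m) / q \<le> 2"
          using q(1) by (simp add: dyadic_Suc field_simps)
        have "(\<Sum>k<Suc m. weight R k * gauss (2 * dyadic R k) y)
            \<le> (\<Sum>k<Suc m. g (dyadic R k) * (D * (dyadic R k / q) ^ (2 * p)))"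
          using g_pos[OF dyadic_pos[OF R0]] weight_nonneg[OF R0]
          by (intro sum_mono mult_mono weight_le R0 decay) (auto simp: gauss_pos less_imp_le)
        also have "\<dots> = D * (\<Sum>k<Suc m. g (dyadic R k) * (dyadic R k / q) ^ (2 * p))"
          by (simp only: sum_distrib_left mult.left_commute)
        also have "\<dots> \<le> D * (g (dyadic R (Suc m)) * (dyadic R (Suc m) / q) ^ (2 * p))"
          using D by (intro mult_left_mono geom) auto
        also have "\<dots> \<le> D * (g (dyadic R (Suc m)) * 2 ^ (2 * p))"
          using D s2 q(1) g_pos[OF dyadic_pos[OF R0, of "Suc m"]] dyadic_pos[OF R0, of "Suc m"]
          by (intro mult_left_mono power_mono) auto
        also have "\<dots> = D * (g (dyadic R (Suc m)) * 4 ^ p)"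
          by (simp only: power4p)
        finally have "g (dyadic R (Suc m)) + (\<Sum>k<Suc m. weight R k * gauss (2 * dyadic R k) y) \<le> C * g (dyadic R (Suc m))"
          by (simp add: C_def algebra_simps)
        also have "\<dots> \<le> C * g (min (dyadic R (Suc m)) q)"
          using C q(1) dyadic_pos[OF R0, of "Suc m"] by (intro mult_left_mono g_antimono) auto
        finally show ?thesis .
      qed
    qed
  qed
  show ?thesis
    using C main by blast
qed

end

section \<open>A supersolution\<close>

locale doubling_levy_process = symmetric_levy_process M X A \<nu> p + doubling_profile g K
  for M :: "'w measure" and X :: "real \<Rightarrow> 'w \<Rightarrow> real ^ 'n"
    and A :: "real ^ 'n ^ 'n" and \<nu> :: "real ^ 'n \<Rightarrow> real" and p :: "real \<Rightarrow> real ^ 'n \<Rightarrow> ennreal"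
    and g :: "real \<Rightarrow> real" and K :: real +
  fixes c :: real
  assumes c_ge_1: "1 \<le> c"
    and \<nu>_le: "\<And>x. x \<noteq> 0 \<Longrightarrow> \<nu> x \<le> c * g (norm x)"
    and g_le: "\<And>x :: real ^ 'n. x \<noteq> 0 \<Longrightarrow> g (norm x) \<le> c * \<nu> x"
begin

section \<open>Tail quantities that vanish as the scale grows\<close>

lemma measurable_g_max:
  assumes R: "0 < R"
  shows "(\<lambda>x :: real ^ 'n. g (max (norm x) R)) \<in> borel_measurable borel"
proof -
  have "mono (\<lambda>s. - g (max s R))"
    using R by (intro monoI) (auto intro!: g_antimono)
  then have "(\<lambda>s. - g (max s R)) \<in> borel_measurable borel"
    by (rule borel_measurable_mono)
  then have [measurable]: "(\<lambda>s. g (max s R)) \<in> borel_measurable borel"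
    by simp
  show ?thesis
    by measurable
qed

text \<open>Outside the unit ball g is dominated by a multiple of the Levy density, which is
  integrable there; inside, the truncation at R keeps the function below g 1.\<close>

lemma integrable_g_max:
  assumes R: "1 \<le> R"
  shows "integrable lborel (\<lambda>x :: real ^ 'n. g (max (norm x) R))"
proof (rule Bochner_Integration.integrable_bound)
  have ball: "integrable lborel (\<lambda>x :: real ^ 'n. g 1 * indicator (ball 0 1) x)"
    using emeasure_lborel_ball_finite[of "0 :: real ^ 'n" 1] by (intro integrable_mult_right) (simp add: integrable_indicator_iff)
  show "integrable lborel (\<lambda>x :: real ^ 'n. c * (\<nu> x * min 1 ((norm x)\<^sup>2)) + g 1 * indicator (ball 0 1) x)"
    by (intro Bochner_Integration.integrable_add ball integrable_mult_right integrable_\<nu>_min)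
  show "(\<lambda>x :: real ^ 'n. g (max (norm x) R)) \<in> borel_measurable lborel"
    using measurable_g_max[of R] R by simp
  show "AE x :: real ^ 'n in lborel. norm (g (max (norm x) R))
      \<le> norm (c * (\<nu> x * min 1 ((norm x)\<^sup>2)) + g 1 * indicator (ball 0 1) x)"
    using AE_\<nu>_nonneg
  proof eventually_elim
    case (elim x)
    have "g (max (norm x) R) \<le> c * (\<nu> x * min 1 ((norm x)\<^sup>2)) + g 1 * indicator (ball 0 1) x"
    proof (cases "norm x < 1")
      case True
      have "0 \<le> c * (\<nu> x * min 1 ((norm x)\<^sup>2))"
        using elim c_ge_1 by simp
      then show ?thesis
        using True R g_antimono[of 1 "max (norm x) R"] by (simp add: dist_norm)
    next
      case False
      then have x: "x \<noteq> 0" and m: "min 1 ((norm x)\<^sup>2) = 1"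
        using one_le_power[of "norm x" 2] by auto
      have "g (max (norm x) R) \<le> g (norm x)"
        using False by (intro g_antimono) auto
      also have "\<dots> \<le> c * \<nu> x"
        by (rule g_le[OF x])
      finally show ?thesis
        using False by (simp add: m dist_norm)
    qed
    moreover have "0 < g (max (norm x) R)"
      using R by (intro g_pos) auto
    ultimately show ?case
      by simp
  qed
qed

text \<open>A positive lower bound for g would make a positive constant integrable over the whole
  space; monotonicity then turns one small value into a limit.\<close>

lemma g_tendsto_0: "(g \<longlongrightarrow> 0) at_top"
proof (rule order_tendstoI)
  fix a :: real
  assume "a < 0"
  then show "\<forall>\<^sub>F u in at_top. a < g u"
    using g_pos by (intro eventually_mono[OF eventually_gt_at_top[of 0]]) (meson less_trans)
next
  fix a :: real
  assume a: "0 < a"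
  have "\<exists>u>0. g u < a"
  proof (rule ccontr)
    assume "\<not> ?thesis"
    then have ge: "a \<le> g u" if "0 < u" for u
      using that \<open>\<not> (\<exists>u>0. g u < a)\<close> by (meson not_less)
    have "integrable lborel (\<lambda>x :: real ^ 'n. a)"
    proof (rule Bochner_Integration.integrable_bound[OF integrable_g_max[of 1]])
      show "AE x :: real ^ 'n in lborel. norm a \<le> norm (g (max (norm x) 1))"
        using a ge[of "max (norm x) 1" for x :: "real ^ 'n"] by (auto intro!: AE_I2 order_trans[OF _ abs_ge_self])
    qed simp_all
    then show False
      using a by (simp add: integrable_iff_bounded ennreal_mult_top)
  qed
  then obtain u where "0 < u" "g u < a"
    by blast
  then show "\<forall>\<^sub>F u in at_top. g u < a"
    using g_antimono by (intro eventually_mono[OF eventually_ge_at_top[of u]]) (meson le_less_trans)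
qed

lemma integral_g_max_tendsto_0: "((\<lambda>R. LINT x|lborel. g (max (norm (x :: real ^ 'n)) R)) \<longlongrightarrow> 0) at_top"
proof -
  \<comment> \<open>The indicator switches the integrand off for R < 1, where measurability at every
    R would otherwise fail to follow from the monotonicity of g on positive arguments.\<close>
  have "((\<lambda>R. LINT x|lborel. g (max (norm (x :: real ^ 'n)) R) * indicator {1..} R)
      \<longlongrightarrow> (LINT x :: real ^ 'n|lborel. 0)) at_top"
  proof (rule integral_dominated_convergence_at_top)
    show "integrable lborel (\<lambda>x :: real ^ 'n. g (max (norm x) 1))"
      by (rule integrable_g_max) simp
    show "\<forall>\<^sub>F R in at_top. AE x :: real ^ 'n in lborel.
        norm (g (max (norm x) R) * indicator {1..} R) \<le> g (max (norm x) 1)"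
      using eventually_ge_at_top[of 1]
    proof eventually_elim
      case (elim R)
      have "0 < g (max (norm x) R)" "g (max (norm x) R) \<le> g (max (norm x) 1)" for x :: "real ^ 'n"
        using elim by (auto intro!: g_pos g_antimono)
      then have "norm (g (max (norm x) R) * indicator {1..} R) \<le> g (max (norm x) 1)" for x :: "real ^ 'n"
        using elim by (simp add: abs_of_pos)
      then show ?case
        by simp
    qed
    show "AE x :: real ^ 'n in lborel. ((\<lambda>R. g (max (norm x) R) * indicator {1..} R) \<longlongrightarrow> 0) at_top"
    proof (intro AE_I2 tendsto_cong[THEN iffD1, OF _ g_tendsto_0])
      fix x :: "real ^ 'n"
      show "\<forall>\<^sub>F R in at_top. g R = g (max (norm x) R) * indicator {1..} R"
        using eventually_ge_at_top[of "max (norm x) 1"] by eventually_elim (auto simp: max_absorb2)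
    qed
    show "(\<lambda>x :: real ^ 'n. g (max (norm x) R) * indicator {1..} R) \<in> borel_measurable lborel" for R
      using measurable_g_max[of R] by (cases "1 \<le> R") simp_all
  qed simp
  moreover have "\<forall>\<^sub>F R in at_top. (LINT x|lborel. g (max (norm (x :: real ^ 'n)) R) * indicator {1..} R)
      = (LINT x|lborel. g (max (norm (x :: real ^ 'n)) R))"
    using eventually_ge_at_top[of 1] by eventually_elim simp
  ultimately have "((\<lambda>R. LINT x|lborel. g (max (norm (x :: real ^ 'n)) R))
      \<longlongrightarrow> (LINT x :: real ^ 'n|lborel. 0)) at_top"
    by (rule Lim_transform_eventually)
  then show ?thesis
    by simp
qed

text \<open>The second moment of the jumps of length at most l, divided by l^2: it measures the
  effect of the short jumps on a function varying on the scale l.\<close>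

definition trunc_moment :: "real \<Rightarrow> real" where
  "trunc_moment l = (LINT z|lborel. \<nu> z * (if norm z \<le> l then (norm z)\<^sup>2 / l\<^sup>2 else 0))"

lemma trunc_moment_bound:
  fixes z :: "real ^ 'n"
  assumes l: "1 \<le> l"
  shows "(if norm z \<le> l then (norm z)\<^sup>2 / l\<^sup>2 else 0) \<le> min 1 ((norm z)\<^sup>2)"
proof (cases "norm z \<le> l")
  case True
  have "(norm z)\<^sup>2 / l\<^sup>2 \<le> 1"
    using True l power_mono[of "norm z" l 2] by simp
  moreover have "(norm z)\<^sup>2 / l\<^sup>2 \<le> (norm z)\<^sup>2 / 1"
    using l by (intro divide_left_mono) auto
  ultimately show ?thesis
    using True by simp
qed simp

lemma integrable_trunc_moment:
  assumes l: "1 \<le> l"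
  shows "integrable lborel (\<lambda>z. \<nu> z * (if norm z \<le> l then (norm z)\<^sup>2 / l\<^sup>2 else 0))"
  using trunc_moment_bound[OF l] by (intro integrable_\<nu>_mult[where C = 1]) auto

lemma trunc_moment_tendsto_0: "(trunc_moment \<longlongrightarrow> 0) at_top"
proof -
  have "((\<lambda>l. LINT z|lborel. \<nu> z * (if norm z \<le> l then (norm z)\<^sup>2 / l\<^sup>2 else 0))
      \<longlongrightarrow> (LINT z :: real ^ 'n|lborel. 0)) at_top"
  proof (rule integral_dominated_convergence_at_top)
    show "integrable lborel (\<lambda>z. \<nu> z * min 1 ((norm z)\<^sup>2))"
      by (rule integrable_\<nu>_min)
    show "\<forall>\<^sub>F l in at_top. AE z in lborel.
        norm (\<nu> z * (if norm z \<le> l then (norm z)\<^sup>2 / l\<^sup>2 else 0)) \<le> \<nu> z * min 1 ((norm z)\<^sup>2)"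
      using eventually_ge_at_top[of 1]
    proof eventually_elim
      case (elim l)
      show ?case
        using AE_\<nu>_nonneg
      proof eventually_elim
        case (elim z)
        then show ?case
          using mult_left_mono[OF trunc_moment_bound[OF \<open>1 \<le> l\<close>, of z] elim] by (simp add: abs_mult)
      qed
    qed
    show "AE z in lborel. ((\<lambda>l. \<nu> z * (if norm z \<le> l then (norm z)\<^sup>2 / l\<^sup>2 else 0)) \<longlongrightarrow> 0) at_top"
    proof (intro AE_I2)
      fix z :: "real ^ 'n"
      have "((\<lambda>l. \<nu> z * ((norm z)\<^sup>2 / l\<^sup>2)) \<longlongrightarrow> 0) at_top"
        by real_asymp
      moreover have "\<forall>\<^sub>F l in at_top. \<nu> z * ((norm z)\<^sup>2 / l\<^sup>2) = \<nu> z * (if norm z \<le> l then (norm z)\<^sup>2 / l\<^sup>2 else 0)"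
        using eventually_ge_at_top[of "norm z"] by eventually_elim simp
      ultimately show "((\<lambda>l. \<nu> z * (if norm z \<le> l then (norm z)\<^sup>2 / l\<^sup>2 else 0)) \<longlongrightarrow> 0) at_top"
        by (rule Lim_transform_eventually)
    qed
    show "(\<lambda>z. \<nu> z * (if norm z \<le> l then (norm z)\<^sup>2 / l\<^sup>2 else 0)) \<in> borel_measurable lborel" for l
      using measurable_\<nu> by measurable
  qed simp
  then show ?thesis
    by (simp add: trunc_moment_def[abs_def])
qed

section \<open>Upper bounds for the generator applied to the mixture\<close>

lemma gauss_sum_le_g_max:
  fixes x :: "real ^ 'n"
  assumes C: "\<And>n. g (dyadic R n) + (\<Sum>k<n. weight R k * gauss (2 * dyadic R k) x) \<le> C * g (min (dyadic R n) (max (norm x) R))"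
    and R: "0 < R"
  shows "(\<Sum>k<n. weight R k * gauss (dyadic R k) x) \<le> C * g (max (norm x) R)"
proof -
  obtain N where N: "max (norm x) R \<le> dyadic R N"
    using dyadic_unbounded[OF R] by blast
  \<comment> \<open>Enlarging the truncation level only adds nonnegative terms, and at level m the
    minimum in the hypothesis no longer cuts anything off.\<close>
  define m where "m = max n N"
  have "dyadic R N \<le> dyadic R m"
    using R by (simp add: dyadic_def m_def)
  then have m: "min (dyadic R m) (max (norm x) R) = max (norm x) R"
    using N by simp
  have "(\<Sum>k<n. weight R k * gauss (dyadic R k) x) \<le> (\<Sum>k<n. weight R k * gauss (2 * dyadic R k) x)"
    using weight_nonneg[OF R] dyadic_pos[OF R]
    by (intro sum_mono mult_left_mono gauss_le_gauss_two_mult) simp_all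
  also have "\<dots> \<le> (\<Sum>k<m. weight R k * gauss (2 * dyadic R k) x)"
    using weight_nonneg[OF R] by (intro sum_mono2) (auto simp: m_def gauss_pos less_imp_le)
  also have "\<dots> \<le> C * g (max (norm x) R)"
    using C[of m] g_pos[OF dyadic_pos[OF R, of m]] unfolding m by simp
  finally show ?thesis .
qed

text \<open>Halving the exponent pays for the polynomial factor: 1 + 8 v <= 9 exp v for v = |y|^2 /
  (8 \<sigma>^2).\<close>

lemma gauss_fourth_le_gauss_eighth:
  fixes y :: "real ^ 'n"
  assumes "0 < \<sigma>"
  shows "(1 + (norm y)\<^sup>2 / \<sigma>\<^sup>2) * exp (- (norm y)\<^sup>2 / (4 * \<sigma>\<^sup>2)) \<le> 9 * gauss (2 * \<sigma>) y"
proof -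
  define v where "v = (norm y)\<^sup>2 / (8 * \<sigma>\<^sup>2)"
  have v: "0 \<le> v"
    by (simp add: v_def)
  have "1 + 8 * v \<le> 9 * exp v"
    using exp_ge_add_one_self[of v] v by linarith
  then have "(1 + 8 * v) * exp (- (2 * v)) \<le> 9 * exp v * exp (- (2 * v))"
    by (intro mult_right_mono) auto
  also have "\<dots> = 9 * exp (- v)"
    by (simp flip: exp_add)
  finally show ?thesis
    by (simp add: v_def gauss_two_mult)
qed

text \<open>Jumps of length at most l are treated by the quadratic bound for each Gaussian; since
  every scale is at least R, the choice of l meets its restriction on z at all scales
  simultaneously. Longer jumps are treated by size alone.\<close>

lemma \<nu>_second_diff_le:
  fixes y z :: "real ^ 'n"
  assumes R: "0 < R" and z: "z \<noteq> 0" and l: "l = max (norm y) R / 8"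
  shows "\<nu> z * second_diff (\<lambda>x. \<Sum>k<n. weight R k * gauss (dyadic R k) x) z y
    \<le> \<nu> z * (if norm z \<le> l then (norm z)\<^sup>2 / l\<^sup>2 else 0) * (9 / 4 * (\<Sum>k<n. weight R k * gauss (2 * dyadic R k) y))
      + c * g l * (((\<Sum>k<n. weight R k * gauss (dyadic R k) (y + z)) + (\<Sum>k<n. weight R k * gauss (dyadic R k) (y - z))) / 2)"
    (is "\<nu> z * second_diff ?w z y \<le> _ * (9 / 4 * ?\<Theta>) + c * g l * ((?w (y + z) + ?w (y - z)) / 2)")
proof -
  have l0: "0 < l"
    using R by (simp add: l)
  have w: "0 \<le> ?w x" for x
    using weight_nonneg[OF R] by (intro sum_nonneg mult_nonneg_nonneg) (auto simp: gauss_pos less_imp_le)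
  have far: "0 \<le> c * g l * ((?w (y + z) + ?w (y - z)) / 2)"
    using c_ge_1 g_pos[OF l0] w by (intro mult_nonneg_nonneg) auto
  show ?thesis
  proof (cases "norm z \<le> l")
    case True
    have "second_diff (gauss (dyadic R k)) z y \<le> (norm z)\<^sup>2 / l\<^sup>2 * (9 / 4) * gauss (2 * dyadic R k) y" for k
    proof -
      define \<sigma> where "\<sigma> = dyadic R k"
      have \<sigma>: "0 < \<sigma>" "R \<le> \<sigma>"
        using R dyadic_pos[of R k] dyadic_ge[of R k] by (auto simp: \<sigma>_def)
      have "norm z \<le> max (norm y) \<sigma> / 8"
        using True \<sigma> by (auto simp: l)
      then have "second_diff (gauss \<sigma>) z y \<le> 16 * ((norm z)\<^sup>2 / \<sigma>\<^sup>2) * exp (- (norm y)\<^sup>2 / (4 * \<sigma>\<^sup>2))"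
        using abs_second_diff_gauss_le[OF \<sigma>(1)] abs_le_D1 by blast
      also have "\<dots> = (norm z)\<^sup>2 / l\<^sup>2 * (16 * (l\<^sup>2 / \<sigma>\<^sup>2)) * exp (- (norm y)\<^sup>2 / (4 * \<sigma>\<^sup>2))"
        using l0 by simp
      \<comment> \<open>16 l^2 is a quarter of (max |y| R)^2, and R is at most \<sigma>.\<close>
      also have "\<dots> \<le> (norm z)\<^sup>2 / l\<^sup>2 * (1 / 4 * (1 + (norm y)\<^sup>2 / \<sigma>\<^sup>2)) * exp (- (norm y)\<^sup>2 / (4 * \<sigma>\<^sup>2))"
      proof (intro mult_right_mono mult_left_mono)
        have "(max (norm y) R)\<^sup>2 \<le> \<sigma>\<^sup>2 + (norm y)\<^sup>2"
          using \<sigma> R power_mono[of R \<sigma> 2] by (simp add: max_def add_increasing2)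
        then show "16 * (l\<^sup>2 / \<sigma>\<^sup>2) \<le> 1 / 4 * (1 + (norm y)\<^sup>2 / \<sigma>\<^sup>2)"
          using \<sigma> by (simp add: l power_divide field_simps)
      qed auto
      also have "\<dots> = (norm z)\<^sup>2 / l\<^sup>2 * (1 / 4) * ((1 + (norm y)\<^sup>2 / \<sigma>\<^sup>2) * exp (- (norm y)\<^sup>2 / (4 * \<sigma>\<^sup>2)))"
        by simp
      also have "\<dots> \<le> (norm z)\<^sup>2 / l\<^sup>2 * (1 / 4) * (9 * gauss (2 * \<sigma>) y)"
        by (intro mult_left_mono gauss_fourth_le_gauss_eighth \<sigma>) auto
      finally show ?thesis
        by (simp add: \<sigma>_def)
    qed
    then have "(\<Sum>k<n. weight R k * second_diff (gauss (dyadic R k)) z y)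
        \<le> (\<Sum>k<n. weight R k * ((norm z)\<^sup>2 / l\<^sup>2 * (9 / 4) * gauss (2 * dyadic R k) y))"
      using weight_nonneg[OF R] by (intro sum_mono mult_left_mono)
    also have "\<dots> = (norm z)\<^sup>2 / l\<^sup>2 * (9 / 4 * ?\<Theta>)"
      by (simp add: sum_distrib_left mult_ac)
    also have "(\<Sum>k<n. weight R k * second_diff (gauss (dyadic R k)) z y) = second_diff ?w z y"
      by (simp add: second_diff_def sum_subtractf[symmetric] sum.distrib[symmetric] sum_divide_distrib algebra_simps add_divide_distrib)
    finally have "\<nu> z * second_diff ?w z y \<le> \<nu> z * ((norm z)\<^sup>2 / l\<^sup>2 * (9 / 4 * ?\<Theta>))"
      using \<nu>_pos[OF z] by (intro mult_left_mono) auto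
    then show ?thesis
      using True far by simp
  next
    case False
    \<comment> \<open>For long jumps the density is at most c g l by monotonicity, and dropping the
      term - w y only increases the second difference.\<close>
    have "\<nu> z \<le> c * g (norm z)"
      by (rule \<nu>_le[OF z])
    also have "\<dots> \<le> c * g l"
      using False l0 c_ge_1 by (intro mult_left_mono g_antimono) auto
    finally have "\<nu> z * ((?w (y + z) + ?w (y - z)) / 2) \<le> c * g l * ((?w (y + z) + ?w (y - z)) / 2)"
      using w by (intro mult_right_mono) auto
    moreover have "second_diff ?w z y \<le> (?w (y + z) + ?w (y - z)) / 2"
      using w[of y] unfolding second_diff_def by linarith
    then have "\<nu> z * second_diff ?w z y \<le> \<nu> z * ((?w (y + z) + ?w (y - z)) / 2)"
      using \<nu>_pos[OF z] by (intro mult_left_mono) auto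
    ultimately show ?thesis
      using False by simp
  qed
qed

text \<open>After integration of the pointwise bound the long jumps see the Gaussian sum only
  through its translates, whose integral does not depend on y.\<close>

lemma integral_\<nu>_second_diff_le:
  fixes y :: "real ^ 'n"
  assumes R: "8 \<le> R" and l: "l = max (norm y) R / 8"
    and C: "\<And>n x :: real ^ 'n. g (dyadic R n) + (\<Sum>k<n. weight R k * gauss (2 * dyadic R k) x)
      \<le> C * g (min (dyadic R n) (max (norm x) R))"
  shows "(\<Sum>k<n. weight R k * (LINT z|lborel. \<nu> z * second_diff (gauss (dyadic R k)) z y))
    \<le> 9 / 4 * trunc_moment l * (\<Sum>k<n. weight R k * gauss (2 * dyadic R k) y)
      + c * g l * (C * (LINT x|lborel. g (max (norm (x :: real ^ 'n)) R)))"
proof -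
  have R0: "0 < R" and R1: "1 \<le> R" and l1: "1 \<le> l"
    using R by (auto simp: l)
  define w where "w x = (\<Sum>k<n. weight R k * gauss (dyadic R k) x)" for x :: "real ^ 'n"
  define \<Theta> where "\<Theta> = (\<Sum>k<n. weight R k * gauss (2 * dyadic R k) y)"
  have [measurable]: "w \<in> borel_measurable borel"
    unfolding w_def by measurable
  have w0: "0 \<le> w x" for x
    unfolding w_def using weight_nonneg[OF R0] by (intro sum_nonneg mult_nonneg_nonneg) (auto simp: gauss_pos less_imp_le)
  have w_le: "w x \<le> C * g (max (norm x) R)" for x
    unfolding w_def by (intro gauss_sum_le_g_max C R0)
  have intG: "integrable lborel (\<lambda>x :: real ^ 'n. C * g (max (norm x) R))"
    by (intro integrable_mult_right integrable_g_max R1)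
  have intw: "integrable lborel w"
    using w0 w_le by (intro Bochner_Integration.integrable_bound[OF intG] AE_I2) (auto intro: order_trans[OF _ abs_ge_self])
  have shift: "integrable lborel (\<lambda>z. w (a + z))" "(LINT z|lborel. w (a + z)) = (LINT z|lborel. w z)" for a
  proof -
    have "integrable (distr lborel borel ((+) a)) w"
      using intw by (simp add: lborel_distr_plus)
    then show "integrable lborel (\<lambda>z. w (a + z))"
      by (subst (asm) integrable_distr_eq) auto
    have "(LINT z|lborel. w z) = (LINT z|distr lborel borel ((+) a). w z)"
      by (simp add: lborel_distr_plus)
    then show "(LINT z|lborel. w (a + z)) = (LINT z|lborel. w z)"
      by (subst (asm) integral_distr) auto
  qed
  \<comment> \<open>Evenness turns the reflected argument into a translation in z.\<close>
  have even: "w (y - z) = w (- y + z)" for z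
    using norm_minus_commute[of y z] by (simp add: w_def gauss_def)
  have sd: "second_diff w z y = (\<Sum>k<n. weight R k * second_diff (gauss (dyadic R k)) z y)" for z
    by (simp add: w_def second_diff_def sum_subtractf[symmetric] sum.distrib[symmetric] sum_divide_distrib algebra_simps add_divide_distrib)
  have int_k: "integrable lborel (\<lambda>z. \<nu> z * second_diff (gauss (dyadic R k)) z y)" for k
    by (intro integrable_\<nu>_second_diff_gauss dyadic_pos R0)
  have split: "\<nu> z * second_diff w z y = (\<Sum>k<n. weight R k * (\<nu> z * second_diff (gauss (dyadic R k)) z y))" for z
    unfolding sd by (simp add: sum_distrib_left mult.left_commute)
  have "(\<Sum>k<n. weight R k * (LINT z|lborel. \<nu> z * second_diff (gauss (dyadic R k)) z y))
      = (LINT z|lborel. \<nu> z * second_diff w z y)"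
    unfolding split using int_k by simp
  also have "\<dots> \<le> (LINT z|lborel. \<nu> z * (if norm z \<le> l then (norm z)\<^sup>2 / l\<^sup>2 else 0) * (9 / 4 * \<Theta>)
      + c * g l * ((w (y + z) + w (- y + z)) / 2))"
  proof (rule integral_mono_AE)
    show "integrable lborel (\<lambda>z. \<nu> z * second_diff w z y)"
      unfolding split using int_k by simp
    show "integrable lborel (\<lambda>z. \<nu> z * (if norm z \<le> l then (norm z)\<^sup>2 / l\<^sup>2 else 0) * (9 / 4 * \<Theta>)
      + c * g l * ((w (y + z) + w (- y + z)) / 2))"
      by (intro Bochner_Integration.integrable_add integrable_mult_right integrable_mult_left integrable_divide
          integrable_trunc_moment l1 shift)
    have "AE z in lborel. z \<noteq> (0 :: real ^ 'n)"
      by (rule AE_lborel_singleton)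
    then show "AE z in lborel. \<nu> z * second_diff w z y \<le> \<nu> z * (if norm z \<le> l then (norm z)\<^sup>2 / l\<^sup>2 else 0) * (9 / 4 * \<Theta>)
      + c * g l * ((w (y + z) + w (- y + z)) / 2)"
    proof eventually_elim
      case (elim z)
      have "\<nu> z * second_diff w z y \<le> \<nu> z * (if norm z \<le> l then (norm z)\<^sup>2 / l\<^sup>2 else 0) * (9 / 4 * \<Theta>)
          + c * g l * ((w (y + z) + w (y - z)) / 2)"
        using \<nu>_second_diff_le[OF R0 elim l, of n] unfolding w_def \<Theta>_def .
      then show ?case
        unfolding even .
    qed
  qed
  also have "\<dots> = trunc_moment l * (9 / 4 * \<Theta>) + c * g l * (LINT x|lborel. w x)"
  proof -
    have "(LINT z|lborel. c * g l * ((w (y + z) + w (- y + z)) / 2)) = c * g l * (LINT x|lborel. w x)"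
      unfolding integral_mult_right_zero integral_divide_zero
        Bochner_Integration.integral_add[OF shift(1) shift(1)] shift(2) by simp
    moreover have "integrable lborel (\<lambda>z. c * g l * ((w (y + z) + w (- y + z)) / 2))"
      by (intro integrable_mult_right integrable_divide Bochner_Integration.integrable_add shift)
    moreover have "integrable lborel (\<lambda>z. \<nu> z * (if norm z \<le> l then (norm z)\<^sup>2 / l\<^sup>2 else 0) * (9 / 4 * \<Theta>))"
      by (intro integrable_mult_left integrable_trunc_moment l1)
    ultimately show ?thesis
      unfolding trunc_moment_def by (subst Bochner_Integration.integral_add) (simp_all only: integral_mult_left_zero)
  qed
  also have "\<dots> \<le> trunc_moment l * (9 / 4 * \<Theta>) + c * g l * (C * (LINT x|lborel. g (max (norm (x :: real ^ 'n)) R)))"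
  proof (intro add_left_mono mult_left_mono)
    have "(LINT x|lborel. w x) \<le> (LINT x :: real ^ 'n|lborel. C * g (max (norm x) R))"
      by (intro integral_mono intw intG w_le)
    then show "(LINT x|lborel. w x) \<le> C * (LINT x|lborel. g (max (norm (x :: real ^ 'n)) R))"
      by simp
    show "0 \<le> c * g l"
      using c_ge_1 g_pos[of l] l1 by simp
  qed
  finally show ?thesis
    by (simp add: \<Theta>_def mult_ac)
qed

text \<open>The second-order part of the generator adds a multiple of 1 / \<sigma>^2 at scale
  \<sigma>, which is at most the same multiple of 1 / R^2.\<close>

lemma sum_gen_le:
  fixes y :: "real ^ 'n"
  assumes R: "8 \<le> R" and l: "l = max (norm y) R / 8"
    and C: "\<And>n x :: real ^ 'n. g (dyadic R n) + (\<Sum>k<n. weight R k * gauss (2 * dyadic R k) x)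
      \<le> C * g (min (dyadic R n) (max (norm x) R))"
  shows "(\<Sum>k<n. weight R k * gen (dyadic R k) y)
    \<le> (64 * (\<Sum>i\<in>UNIV. \<Sum>j\<in>UNIV. \<bar>A $ i $ j\<bar>) / R\<^sup>2 + 9 / 4 * trunc_moment l)
        * (\<Sum>k<n. weight R k * gauss (2 * dyadic R k) y)
      + c * g l * (C * (LINT x|lborel. g (max (norm (x :: real ^ 'n)) R)))"
proof -
  define a where "a = (\<Sum>i\<in>UNIV. \<Sum>j\<in>UNIV. \<bar>A $ i $ j\<bar>)"
  have a: "0 \<le> a"
    by (simp add: a_def sum_nonneg)
  have R0: "0 < R"
    using R by simp
  have "gen (dyadic R k) y \<le> 64 * a / R\<^sup>2 * gauss (2 * dyadic R k) y
      + (LINT z|lborel. \<nu> z * second_diff (gauss (dyadic R k)) z y)" for k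
  proof -
    define \<sigma> where "\<sigma> = dyadic R k"
    have \<sigma>: "0 < \<sigma>" "R \<le> \<sigma>"
      using R0 dyadic_pos[of R k] dyadic_ge[of R k] by (auto simp: \<sigma>_def)
    have "gen \<sigma> y \<le> 64 * a / \<sigma>\<^sup>2 * exp (- (norm y)\<^sup>2 / (4 * \<sigma>\<^sup>2)) + (LINT z|lborel. \<nu> z * second_diff (gauss \<sigma>) z y)"
      unfolding gen_eq[OF \<sigma>(1)] a_def using abs_integral_cos_quadratic_form_le[OF \<sigma>(1), of y A] by linarith
    moreover have "64 * a / \<sigma>\<^sup>2 * exp (- (norm y)\<^sup>2 / (4 * \<sigma>\<^sup>2)) \<le> 64 * a / R\<^sup>2 * gauss (2 * \<sigma>) y"
    proof (intro mult_mono)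
      show "64 * a / \<sigma>\<^sup>2 \<le> 64 * a / R\<^sup>2"
        using a \<sigma> R0 by (intro divide_left_mono power_mono) auto
      show "exp (- (norm y)\<^sup>2 / (4 * \<sigma>\<^sup>2)) \<le> gauss (2 * \<sigma>) y"
        using \<sigma> by (simp add: gauss_two_mult divide_left_mono)
    qed (use a in auto)
    ultimately show ?thesis
      by (simp add: \<sigma>_def)
  qed
  then have "(\<Sum>k<n. weight R k * gen (dyadic R k) y) \<le>
      (\<Sum>k<n. weight R k * (64 * a / R\<^sup>2 * gauss (2 * dyadic R k) y + (LINT z|lborel. \<nu> z * second_diff (gauss (dyadic R k)) z y)))"
    using weight_nonneg[OF R0] by (intro sum_mono mult_left_mono)
  also have "\<dots> = 64 * a / R\<^sup>2 * (\<Sum>k<n. weight R k * gauss (2 * dyadic R k) y)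
      + (\<Sum>k<n. weight R k * (LINT z|lborel. \<nu> z * second_diff (gauss (dyadic R k)) z y))"
    by (simp add: distrib_left sum.distrib sum_distrib_left mult_ac)
  finally show ?thesis
    using integral_\<nu>_second_diff_le[OF R l C, of n] by (simp add: a_def distrib_right)
qed

text \<open>The generator bound gives growth at rate \<eta> to first order in h. The second-order
  error is uniform in y and the mixture is bounded below by its constant part, so for small h the
  error costs at most a second \<eta>.\<close>

lemma mixture_supersolution:
  fixes y :: "real ^ 'n"
  assumes R: "0 < R" and \<eta>: "0 < \<eta>"
    and gen: "\<And>y. (\<Sum>k<n. weight R k * gen (dyadic R k) y) \<le> \<eta> * mixture R n y"
  shows "\<exists>h0>0. \<forall>h y. 0 < h \<and> h \<le> h0 \<longrightarrow>
    expectation (\<lambda>\<omega>. mixture R n (y + X h \<omega>)) \<le> exp (2 * \<eta> * h) * mixture R n y"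
proof -
  define V where "V k = 2 * (LINT \<xi>|std_gaussian. (\<psi> (\<xi> /\<^sub>R dyadic R k))\<^sup>2)" for k
  define B where "B = (\<Sum>k<n. weight R k * V k)"
  have B: "0 \<le> B"
    unfolding B_def V_def using weight_nonneg[OF R] by (intro sum_nonneg mult_nonneg_nonneg) auto
  define b where "b = g (dyadic R n)"
  have b: "0 < b"
    unfolding b_def by (intro g_pos dyadic_pos R)
  \<comment> \<open>Then h B <= \<eta> b whenever h <= h0; the added 1 avoids division by
    zero.\<close>
  define h0 where "h0 = \<eta> * b / (B + 1)"
  have h0: "0 < h0"
    using \<eta> b B by (simp add: h0_def)
  have "expectation (\<lambda>\<omega>. mixture R n (y + X h \<omega>)) \<le> exp (2 * \<eta> * h) * mixture R n y"
    if h: "0 < h" "h \<le> h0" for h y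
  proof -
    note [measurable] = measurable_X[of h]
    have int: "integrable M (\<lambda>\<omega>. gauss (dyadic R k) (y + X h \<omega>))" for k
      using h by (intro integrable_const_bound[where B = 1]) (auto simp: gauss_le_1 gauss_pos less_imp_le)
    have "h * B \<le> h0 * (B + 1)"
      using h B by (intro mult_mono) auto
    also have "\<dots> = \<eta> * b"
      using B by (simp add: h0_def)
    also have "\<dots> \<le> \<eta> * mixture R n y"
      using \<eta> g_dyadic_le_mixture[OF R, of n y] by (simp add: b_def)
    finally have hB: "h * (h * B) \<le> h * (\<eta> * mixture R n y)"
      using h by (intro mult_left_mono) auto
    have "expectation (\<lambda>\<omega>. mixture R n (y + X h \<omega>))
        = b + (\<Sum>k<n. weight R k * expectation (\<lambda>\<omega>. gauss (dyadic R k) (y + X h \<omega>)))"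
      unfolding mixture_def b_def using int by (simp add: prob_space)
    also have "\<dots> \<le> b + (\<Sum>k<n. weight R k * (gauss (dyadic R k) y + h * gen (dyadic R k) y + h\<^sup>2 * V k))"
      unfolding V_def using h weight_nonneg[OF R]
      by (intro add_left_mono sum_mono mult_left_mono expectation_gauss_le dyadic_pos R) auto
    also have "\<dots> = mixture R n y + h * (\<Sum>k<n. weight R k * gen (dyadic R k) y) + h * (h * B)"
      by (simp add: mixture_def b_def B_def distrib_left sum.distrib sum_distrib_left power2_eq_square mult_ac)
    also have "\<dots> \<le> mixture R n y + h * (\<eta> * mixture R n y) + h * (\<eta> * mixture R n y)"
      using h by (intro add_mono mult_left_mono gen hB) auto
    also have "\<dots> = (1 + 2 * \<eta> * h) * mixture R n y"
      by (simp add: algebra_simps)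
    also have "\<dots> \<le> exp (2 * \<eta> * h) * mixture R n y"
      using mixture_pos[OF R, of n y] by (intro mult_right_mono) (simp_all add: less_imp_le)
    finally show ?thesis .
  qed
  then show ?thesis
    using h0 by blast
qed

text \<open>The order of the quantifiers matters: C comes from doubling alone, R is then taken large
  enough for the generator estimate, and n stays free so that it can follow the point of evaluation.
  The step bound h0 may depend on n.\<close>

lemma exists_supersolution:
  assumes \<eta>: "0 < \<eta>"
  shows "\<exists>C. \<forall>R0. \<exists>R\<ge>R0. 1 \<le> R \<and>
     (\<forall>n. \<exists>h0>0. \<forall>h y. 0 < h \<and> h \<le> h0 \<longrightarrow>
        expectation (\<lambda>\<omega>. mixture R n (y + X h \<omega>)) \<le> exp (\<eta> * h) * mixture R n y) \<and>
     (\<forall>n y. max (norm y) R \<le> dyadic R n \<longrightarrow> mixture R n (y :: real ^ 'n) \<le> C * g (max (norm y) R))"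
proof -
  obtain C where C1: "1 \<le> C" and C: "\<And>R n x :: real ^ 'n. 1 \<le> R \<Longrightarrow>
      g (dyadic R n) + (\<Sum>k<n. weight R k * gauss (2 * dyadic R k) x) \<le> C * g (min (dyadic R n) (max (norm x) R))"
    using gauss_mixture_upper by blast
  define e where "e = exp (1 / 2 :: real)"
  have e: "1 \<le> e" "e * exp (- 1 / 2) = 1"
    by (simp_all add: e_def flip: exp_add)
  define a where "a = (\<Sum>i\<in>UNIV. \<Sum>j\<in>UNIV. \<bar>A $ i $ j\<bar>)"
  \<comment> \<open>Each of the two error terms in \<open>sum_gen_le\<close> is allotted \<eta> / 4
    times the mixture; the denominators collect the constants comparing \<Theta> and g l with
    it.\<close>
  define \<epsilon>1 where "\<epsilon>1 = \<eta> / (4 * (C * K * e))"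
  define \<epsilon>2 where "\<epsilon>2 = \<eta> / (4 * (c * K ^ 4 * e * C))"
  have pos: "0 < C * K * e" "0 < c * K ^ 4 * e * C"
    using C1 K_ge_1 e c_ge_1 by auto
  then have \<epsilon>: "0 < \<epsilon>1" "0 < \<epsilon>2"
    using \<eta> by (auto simp: \<epsilon>1_def \<epsilon>2_def)
  have "((\<lambda>R. 64 * a / R\<^sup>2) \<longlongrightarrow> 0) at_top"
    by real_asymp
  then have ev1: "\<forall>\<^sub>F R in at_top. 64 * a / R\<^sup>2 < \<epsilon>1 / 2"
    using \<epsilon> by (intro order_tendstoD(2)) auto
  have "\<forall>\<^sub>F l in at_top. trunc_moment l < 4 / 9 * (\<epsilon>1 / 2)"
    using \<epsilon> by (intro order_tendstoD(2)[OF trunc_moment_tendsto_0]) auto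
  then obtain l0 where l0: "\<And>l. l0 \<le> l \<Longrightarrow> trunc_moment l < 4 / 9 * (\<epsilon>1 / 2)"
    by (auto simp: eventually_at_top_linorder)
  have ev3: "\<forall>\<^sub>F R in at_top. (LINT x|lborel. g (max (norm (x :: real ^ 'n)) R)) < \<epsilon>2"
    using \<epsilon> by (intro order_tendstoD(2)[OF integral_g_max_tendsto_0]) auto
  show ?thesis
  proof (rule exI[of _ C], rule allI)
    fix R0 :: real
    have "\<forall>\<^sub>F R in at_top. R0 \<le> R \<and> 8 \<le> R \<and> 8 * l0 \<le> R \<and> 64 * a / R\<^sup>2 < \<epsilon>1 / 2
        \<and> (LINT x|lborel. g (max (norm (x :: real ^ 'n)) R)) < \<epsilon>2"
      using ev1 ev3 by (intro eventually_conj eventually_ge_at_top)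
    then obtain R where R: "R0 \<le> R" "8 \<le> R" "8 * l0 \<le> R" "64 * a / R\<^sup>2 < \<epsilon>1 / 2"
        "(LINT x|lborel. g (max (norm (x :: real ^ 'n)) R)) < \<epsilon>2"
      by (auto simp: eventually_at_top_linorder)
    have Rp: "0 < R" "1 \<le> R"
      using R by auto
    have gen: "(\<Sum>k<n. weight R k * gen (dyadic R k) y) \<le> \<eta> / 2 * mixture R n y" for n and y :: "real ^ 'n"
    proof -
      define q where "q = max (norm y) R"
      define w where "w = mixture R n y"
      define \<Theta> where "\<Theta> = (\<Sum>k<n. weight R k * gauss (2 * dyadic R k) y)"
      have q: "8 \<le> q" "R \<le> q"
        using R by (auto simp: q_def)
      have w: "0 < w"
        unfolding w_def by (intro mixture_pos Rp)
      have \<Theta>0: "0 \<le> \<Theta>"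
        unfolding \<Theta>_def using weight_nonneg[OF Rp(1)]
        by (intro sum_nonneg mult_nonneg_nonneg) (auto simp: gauss_pos less_imp_le)
      have "e * (exp (- 1 / 2) * g (2 * q)) \<le> e * w"
        unfolding q_def w_def using e by (intro mult_left_mono mixture_lower Rp) auto
      then have g2q: "g (2 * q) \<le> e * w"
        unfolding mult.assoc[symmetric] e(2) by simp
      have gq: "g q \<le> K * e * w"
        using order_trans[OF doubling[of q] mult_left_mono[OF g2q]] q K_ge_1 by (simp add: mult.assoc)
      \<comment> \<open>Three more doublings lead from l = q / 8 up to q; they are admissible
        because q / 8 is at least 1.\<close>
      have "g (q / 8) \<le> K * g (q / 4)" "g (q / 4) \<le> K * g (q / 2)" "g (q / 2) \<le> K * g q"
        using doubling[of "q / 8"] doubling[of "q / 4"] doubling[of "q / 2"] q by simp_all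
      then have "g (q / 8) \<le> K * (K * (K * g q))"
        using K_ge_1 by (meson mult_left_mono order_trans zero_le_one)
      also have "\<dots> \<le> K * (K * (K * (K * e * w)))"
        using K_ge_1 gq by (intro mult_left_mono) auto
      finally have gl: "g (q / 8) \<le> K ^ 4 * e * w"
        by (simp add: power4_eq_xxxx mult.assoc)
      \<comment> \<open>If truncation occurs below q, the leftover constant of the mixture is
        already as large as the left-hand side.\<close>
      have "g (min (dyadic R n) q) \<le> K * e * w"
      proof (cases "dyadic R n \<le> q")
        case True
        have "1 * 1 * w \<le> K * e * w"
          using K_ge_1 e w by (intro mult_right_mono mult_mono) auto
        then show ?thesis
          using True g_dyadic_le_mixture[OF Rp(1), of n y] by (simp add: w_def)
      qed (use gq in simp)
      then have "C * g (min (dyadic R n) q) \<le> C * (K * e * w)"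
        using C1 by (intro mult_left_mono) auto
      then have \<Theta>: "\<Theta> \<le> C * K * e * w"
        using C[OF Rp(2), of n y] g_pos[OF dyadic_pos[OF Rp(1), of n]]
        unfolding q_def[symmetric] \<Theta>_def[symmetric] by (simp add: mult.assoc)
      have int0: "0 \<le> (LINT x|lborel. g (max (norm (x :: real ^ 'n)) R))"
        using Rp by (intro Bochner_Integration.integral_nonneg less_imp_le[OF g_pos]) auto
      have g0: "0 \<le> g (q / 8)"
        using g_pos[of "q / 8"] q by simp
      have tm: "9 / 4 * trunc_moment (q / 8) < \<epsilon>1 / 2"
        using l0[of "q / 8"] R q by simp
      have "(\<Sum>k<n. weight R k * gen (dyadic R k) y) \<le> (64 * a / R\<^sup>2 + 9 / 4 * trunc_moment (q / 8)) * \<Theta>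
          + c * g (q / 8) * (C * (LINT x|lborel. g (max (norm (x :: real ^ 'n)) R)))"
        unfolding a_def \<Theta>_def by (rule sum_gen_le[OF R(2)]) (simp_all add: q_def C[OF Rp(2)])
      also have "\<dots> \<le> \<epsilon>1 * (C * K * e * w) + c * (K ^ 4 * e * w) * (C * \<epsilon>2)"
      proof (intro add_mono mult_mono)
        show "64 * a / R\<^sup>2 + 9 / 4 * trunc_moment (q / 8) \<le> \<epsilon>1"
          using R(4) tm by linarith
      qed (use C1 c_ge_1 K_ge_1 e w \<epsilon> gl \<Theta> \<Theta>0 R(5) int0 g0 in auto)
      also have "\<dots> = \<eta> / 2 * w"
        using pos C1 K_ge_1 e c_ge_1 by (simp add: \<epsilon>1_def \<epsilon>2_def field_simps)
      finally show ?thesis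
        by (simp add: w_def)
    qed
    show "\<exists>R\<ge>R0. 1 \<le> R \<and>
     (\<forall>n. \<exists>h0>0. \<forall>h y. 0 < h \<and> h \<le> h0 \<longrightarrow>
        expectation (\<lambda>\<omega>. mixture R n (y + X h \<omega>)) \<le> exp (\<eta> * h) * mixture R n y) \<and>
     (\<forall>n y. max (norm y) R \<le> dyadic R n \<longrightarrow> mixture R n (y :: real ^ 'n) \<le> C * g (max (norm y) R))"
    proof (rule exI[of _ R], intro conjI allI impI R(1) Rp(2))
      \<comment> \<open>The generator bound was arranged with rate \<eta> / 2, which
        \<open>mixture_supersolution\<close> doubles.\<close>
      show "\<exists>h0>0. \<forall>h y. 0 < h \<and> h \<le> h0 \<longrightarrow>
        expectation (\<lambda>\<omega>. mixture R n (y + X h \<omega>)) \<le> exp (\<eta> * h) * mixture R n y" for n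
        using mixture_supersolution[OF Rp(1) half_gt_zero[OF \<eta>] gen, of n] by simp
      fix n and y :: "real ^ 'n"
      assume m: "max (norm y) R \<le> dyadic R n"
      have "mixture R n y \<le> g (dyadic R n) + (\<Sum>k<n. weight R k * gauss (2 * dyadic R k) y)"
        unfolding mixture_def using weight_nonneg[OF Rp(1)]
        by (intro add_left_mono sum_mono mult_left_mono gauss_le_gauss_two_mult dyadic_pos Rp) auto
      also have "\<dots> \<le> C * g (max (norm y) R)"
        using C[OF Rp(2), of n y] m by (simp add: min_absorb2)
      finally show "mixture R n y \<le> C * g (max (norm y) R)" .
    qed
  qed
qed

end

section \<open>A maximal inequality\<close>

text \<open>For 0 < a <= 1 this is a to the power of the first visit to H up to time m, and 0
  without a visit. The supremum form avoids stopping times.\<close>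

definition disc_hit :: "real \<Rightarrow> 'b set \<Rightarrow> (nat \<Rightarrow> 'b) \<Rightarrow> nat \<Rightarrow> ennreal" where
  "disc_hit a H s m = (SUP k\<in>{..m}. ennreal (a ^ k) * indicator H (s k))"

lemma disc_hit_0: "disc_hit a H s 0 = indicator H (s 0)"
  by (simp add: disc_hit_def)

lemma disc_hit_Suc: "disc_hit a H s (Suc m) = max (ennreal (a ^ Suc m) * indicator H (s (Suc m))) (disc_hit a H s m)"
  unfolding disc_hit_def atMost_Suc by (simp add: sup_max)

lemma disc_hit_cong: "(\<And>k. k \<le> m \<Longrightarrow> s k = s' k) \<Longrightarrow> disc_hit a H s m = disc_hit a H s' m"
  unfolding disc_hit_def by (intro SUP_cong) auto

lemma disc_hit_ge:
  assumes "0 \<le> a" "a \<le> 1" "disc_hit a H s m \<noteq> 0"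
  shows "ennreal (a ^ m) \<le> disc_hit a H s m"
proof -
  have "\<exists>k\<le>m. s k \<in> H"
  proof (rule ccontr)
    assume "\<not> ?thesis"
    then have "disc_hit a H s m = (SUP k\<in>{..m}. 0)"
      unfolding disc_hit_def by (intro SUP_cong) auto
    then show False
      using assms(3) by simp
  qed
  then obtain k where k: "k \<le> m" "s k \<in> H"
    by blast
  have "ennreal (a ^ m) \<le> ennreal (a ^ k)"
    using assms k by (intro ennreal_leI power_decreasing) auto
  also have "\<dots> = ennreal (a ^ k) * indicator H (s k)"
    using k by simp
  also have "\<dots> \<le> disc_hit a H s m"
    unfolding disc_hit_def using k by (intro SUP_upper) auto
  finally show ?thesis .
qed

lemma measurable_disc_hit:
  assumes [measurable]: "H \<in> sets N'" and s: "\<And>k. k \<le> m \<Longrightarrow> s k \<in> measurable N N'"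
  shows "(\<lambda>z. disc_hit a H (\<lambda>k. s k z) m) \<in> borel_measurable N"
proof -
  have "(\<lambda>z. indicator H (s k z) :: ennreal) \<in> borel_measurable N" if "k \<le> m" for k
    using s[OF that] by measurable
  then show ?thesis
    unfolding disc_hit_def by (intro borel_measurable_SUP borel_measurable_times) auto
qed

lemma measurable_partial_sum:
  fixes x :: "'b::euclidean_space" and k m :: nat
  assumes N: "sets N = sets borel" and k: "k \<le> m"
  shows "(\<lambda>z. x + (\<Sum>i<k. z i)) \<in> borel_measurable (PiM {..<m} (\<lambda>_. N))"
proof (intro borel_measurable_add borel_measurable_sum borel_measurable_const)
  fix i
  assume "i \<in> {..<k}"
  then have "(\<lambda>z. z i) \<in> measurable (PiM {..<m} (\<lambda>_. N)) N"
    using k by (intro measurable_component_singleton) auto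
  then show "(\<lambda>z. z i) \<in> borel_measurable (PiM {..<m} (\<lambda>_. N))"
    by (simp cong: measurable_cong_sets add: N)
qed

text \<open>Doob's argument: discounted by a, the function w is a supermartingale along the walk,
  and it is at least c on H. Stopping at the first visit to H gives the bound.\<close>

lemma random_walk_maximal_inequality:
  fixes \<mu> :: "'b::euclidean_space measure" and w :: "'b \<Rightarrow> real"
  assumes \<mu>: "prob_space \<mu>" "sets \<mu> = sets borel"
    and a: "0 < a" "a \<le> 1" and H [measurable]: "H \<in> sets borel"
    and w [measurable]: "w \<in> borel_measurable borel" and w0: "\<And>y. 0 \<le> w y"
    and c: "0 \<le> c" "\<And>y. y \<in> H \<Longrightarrow> c \<le> w y"
    and step: "\<And>y. (\<integral>\<^sup>+ z. ennreal (w (y + z)) \<partial>\<mu>) \<le> ennreal (w y / a)"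
  shows "(\<integral>\<^sup>+ z. ennreal c * disc_hit a H (\<lambda>k. x + (\<Sum>i<k. z i)) m \<partial>PiM {..<m} (\<lambda>_. \<mu>)) \<le> ennreal (w x)"
proof -
  note [measurable_cong] = \<mu>(2)
  interpret \<mu>: prob_space \<mu>
    by (rule \<mu>)
  interpret P: product_prob_space "\<lambda>_ :: nat. \<mu>" UNIV
    by (intro product_prob_spaceI \<mu>)
  define S where "S k z = x + (\<Sum>i<k. z i)" for k :: nat and z :: "nat \<Rightarrow> 'b"
  define J where "J m z = disc_hit a H (\<lambda>k. S k z) m" for m z
  \<comment> \<open>The stopped process, with w replaced by its lower bound c at the visit to
    H.\<close>
  define \<Psi> where "\<Psi> m z = (if J m z \<noteq> 0 then ennreal c * J m z else ennreal (a ^ m * w (S m z)))" for m z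
  have S_meas: "S k \<in> borel_measurable (PiM {..<m} (\<lambda>_. \<mu>))" if "k \<le> m" for k m
    unfolding S_def by (rule measurable_partial_sum[OF \<mu>(2) that])
  have J_meas [measurable]: "J m \<in> borel_measurable (PiM {..<m} (\<lambda>_. \<mu>))" for m
    unfolding J_def by (intro measurable_disc_hit[OF H] S_meas)
  have \<Psi>_meas: "\<Psi> m \<in> borel_measurable (PiM {..<m} (\<lambda>_. \<mu>))" for m
    unfolding \<Psi>_def using S_meas[of m m] by measurable
  have S_upd: "S k (z(m := y)) = S k z" if "k \<le> m" for k m z y
    unfolding S_def using that by (intro arg_cong2[where f = "(+)"] refl sum.cong) auto
  have S_Suc_upd: "S (Suc m) (z(m := y)) = S m z + y" for m z y
    using S_upd[of m m z y] by (simp add: S_def)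
  have main: "(\<integral>\<^sup>+ z. \<Psi> m z \<partial>PiM {..<m} (\<lambda>_. \<mu>)) \<le> ennreal (w x)" for m
  proof (induction m)
    case 0
    have "\<Psi> 0 z \<le> ennreal (w x)" for z
      unfolding \<Psi>_def J_def disc_hit_0 using c by (auto simp: S_def indicator_def ennreal_leI)
    then have "(\<integral>\<^sup>+ z. \<Psi> 0 z \<partial>PiM {..<0 :: nat} (\<lambda>_. \<mu>)) \<le> (\<integral>\<^sup>+ z. ennreal (w x) \<partial>PiM {..<0 :: nat} (\<lambda>_. \<mu>))"
      by (intro nn_integral_mono)
    also have "\<dots> = ennreal (w x)"
      using P.emeasure_space_1 by (simp add: space_PiM_empty)
    finally show ?case .
  next
    case (Suc m)
    have inner: "(\<integral>\<^sup>+ y. \<Psi> (Suc m) (z(m := y)) \<partial>\<mu>) \<le> \<Psi> m z" for z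
    proof -
      have J_upd: "J m (z(m := y)) = J m z" for y
        unfolding J_def by (intro disc_hit_cong S_upd)
      have J_Suc: "J (Suc m) (z(m := y)) = max (ennreal (a ^ Suc m) * indicator H (S m z + y)) (J m z)" for y
        using J_upd[of y] unfolding J_def disc_hit_Suc S_Suc_upd by simp
      show ?thesis
      proof (cases "J m z = 0")
        case False
        \<comment> \<open>After a visit, later visits carry no larger discount factor, so the value
          is frozen.\<close>
        have "ennreal (a ^ Suc m) * indicator H (S m z + y) \<le> J m z" for y
        proof -
          have "ennreal (a ^ Suc m) * indicator H (S m z + y) \<le> ennreal (a ^ m) * 1"
            using a by (intro mult_mono ennreal_leI power_decreasing) (auto simp: indicator_def)
          also have "\<dots> \<le> J m z"
            using disc_hit_ge[of a H "\<lambda>k. S k z" m] a False by (simp add: J_def)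
          finally show ?thesis .
        qed
        then have "J (Suc m) (z(m := y)) = J m z" for y
          unfolding J_Suc by (simp add: max_absorb2)
        then have "\<Psi> (Suc m) (z(m := y)) = \<Psi> m z" for y
          using False by (simp add: \<Psi>_def)
        then show ?thesis
          by (simp add: \<mu>.emeasure_space_1)
      next
        case True
        \<comment> \<open>Before any visit the new value is at most the discounted w, on H because c
          <= w there; one factor a then cancels the growth allowed by \<open>step\<close>.\<close>
        have "\<Psi> (Suc m) (z(m := y)) \<le> ennreal (a ^ Suc m) * ennreal (w (S m z + y))" for y
        proof (cases "S m z + y \<in> H")
          case H: True
          have "J (Suc m) (z(m := y)) = ennreal (a ^ Suc m)"
            unfolding J_Suc True using H by simp
          moreover have "ennreal (a ^ Suc m) \<noteq> 0"
            using a by simp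
          ultimately have "\<Psi> (Suc m) (z(m := y)) = ennreal c * ennreal (a ^ Suc m)"
            by (simp add: \<Psi>_def)
          also have "\<dots> \<le> ennreal (w (S m z + y)) * ennreal (a ^ Suc m)"
            using c H by (intro mult_right_mono ennreal_leI) auto
          finally show ?thesis
            by (simp only: mult.commute)
        next
          case H: False
          have "J (Suc m) (z(m := y)) = 0"
            unfolding J_Suc True using H by simp
          then show ?thesis
            using a w0 by (simp add: \<Psi>_def S_Suc_upd ennreal_mult del: power_Suc)
        qed
        then have "(\<integral>\<^sup>+ y. \<Psi> (Suc m) (z(m := y)) \<partial>\<mu>) \<le> (\<integral>\<^sup>+ y. ennreal (a ^ Suc m) * ennreal (w (S m z + y)) \<partial>\<mu>)"
          by (intro nn_integral_mono)
        also have "\<dots> = ennreal (a ^ Suc m) * (\<integral>\<^sup>+ y. ennreal (w (S m z + y)) \<partial>\<mu>)"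
          by (intro nn_integral_cmult) measurable
        also have "\<dots> \<le> ennreal (a ^ Suc m) * ennreal (w (S m z) / a)"
          by (intro mult_left_mono step) simp
        also have "\<dots> = ennreal (a ^ m * w (S m z))"
          using a w0 by (simp flip: ennreal_mult)
        also have "\<dots> = \<Psi> m z"
          using True by (simp add: \<Psi>_def)
        finally show ?thesis .
      qed
    qed
    \<comment> \<open>Integrating out the last increment first replaces conditioning on the
      past.\<close>
    have "(\<integral>\<^sup>+ z. \<Psi> (Suc m) z \<partial>PiM {..<Suc m} (\<lambda>_. \<mu>))
        = (\<integral>\<^sup>+ z. \<integral>\<^sup>+ y. \<Psi> (Suc m) (z(m := y)) \<partial>\<mu> \<partial>PiM {..<m} (\<lambda>_. \<mu>))"
      using \<Psi>_meas[of "Suc m"] unfolding lessThan_Suc by (intro P.product_nn_integral_insert) auto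
    also have "\<dots> \<le> (\<integral>\<^sup>+ z. \<Psi> m z \<partial>PiM {..<m} (\<lambda>_. \<mu>))"
      by (intro nn_integral_mono inner)
    also have "\<dots> \<le> ennreal (w x)"
      by (rule Suc.IH)
    finally show ?case .
  qed
  have "(\<integral>\<^sup>+ z. ennreal c * J m z \<partial>PiM {..<m} (\<lambda>_. \<mu>)) \<le> (\<integral>\<^sup>+ z. \<Psi> m z \<partial>PiM {..<m} (\<lambda>_. \<mu>))"
    by (intro nn_integral_mono) (simp add: \<Psi>_def)
  then show ?thesis
    using main[of m] by (simp add: J_def S_def)
qed

section \<open>From random walk skeletons to exit times in continuous time\<close>

context levy_process
begin

lemma distr_skeleton_increments:
  assumes \<delta>: "0 < \<delta>" and m: "0 < m"
  shows "distr M (PiM {..<m} (\<lambda>_. borel)) (\<lambda>\<omega>. \<lambda>i\<in>{..<m}. X (real (Suc i) * \<delta>) \<omega> - X (real i * \<delta>) \<omega>)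
    = PiM {..<m} (\<lambda>_. distr M borel (X \<delta>))"
proof -
  have rv: "random_variable borel (\<lambda>\<omega>. X (real (Suc i) * \<delta>) \<omega> - X (real i * \<delta>) \<omega>)" for i
    using \<delta> by (intro borel_measurable_diff measurable_X) auto
  have ind: "indep_vars (\<lambda>_. borel) (\<lambda>i \<omega>. X (real (Suc i) * \<delta>) \<omega> - X (real i * \<delta>) \<omega>) {..<m}"
    using independent_increments[of "\<lambda>i. real i * \<delta>" m] \<delta> by simp
  have law: "distr M borel (\<lambda>\<omega>. X (real (Suc i) * \<delta>) \<omega> - X (real i * \<delta>) \<omega>) = distr M borel (X \<delta>)" for i
    using stationary_increments[of "real i * \<delta>" \<delta>] \<delta> by (simp add: distrib_right add.commute)
  have "{..<m} \<noteq> {}"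
    using m by auto
  from indep_vars_iff_distr_eq_PiM[THEN iffD1, OF this rv ind] show ?thesis
    unfolding law .
qed

text \<open>The process at multiples of \<delta> is a random walk with step law that of X \<delta>.
  The bound does not involve the horizon, so monotone convergence extends it to all k.\<close>

lemma skeleton_maximal_inequality:
  fixes w :: "real ^ 'n \<Rightarrow> real"
  assumes \<delta>: "0 < \<delta>" and \<eta>: "0 < \<eta>" and H [measurable]: "H \<in> sets borel"
    and w [measurable]: "w \<in> borel_measurable borel" and w0: "\<And>y. 0 \<le> w y"
    and c: "0 < c" "\<And>y. y \<in> H \<Longrightarrow> c \<le> w y"
    and step: "\<And>y. (\<integral>\<^sup>+ \<omega>. ennreal (w (y + X \<delta> \<omega>)) \<partial>M) \<le> ennreal (exp (\<eta> * \<delta>) * w y)"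
  shows "(\<integral>\<^sup>+ \<omega>. (SUP k. ennreal (exp (- \<eta> * (real k * \<delta>))) * indicator H (x + X (real k * \<delta>) \<omega>)) \<partial>M) \<le> ennreal (w x / c)"
proof -
  define a where "a = exp (- \<eta> * \<delta>)"
  have a: "0 < a" "a \<le> 1"
    using \<eta> \<delta> by (auto simp: a_def)
  have ak: "a ^ k = exp (- \<eta> * (real k * \<delta>))" for k
    unfolding a_def by (simp add: exp_of_nat_mult[symmetric] algebra_simps)
  define J where "J m \<omega> = disc_hit a H (\<lambda>k. x + X (real k * \<delta>) \<omega>) m" for m \<omega>
  have [measurable]: "X (real k * \<delta>) \<in> borel_measurable M" for k
    using \<delta> by (intro measurable_X) simp
  have [measurable]: "J m \<in> borel_measurable M" for m
    unfolding J_def disc_hit_def by measurable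
  have J_le: "(\<integral>\<^sup>+ \<omega>. ennreal c * J m \<omega> \<partial>M) \<le> ennreal (w x)" if m: "0 < m" for m
  proof -
    define Z where "Z \<omega> = (\<lambda>i\<in>{..<m}. X (real (Suc i) * \<delta>) \<omega> - X (real i * \<delta>) \<omega>)" for \<omega>
    define S where "S k z = x + (\<Sum>i<k. z i)" for k :: nat and z :: "nat \<Rightarrow> real ^ 'n"
    have Z_meas: "Z \<in> measurable M (PiM {..<m} (\<lambda>_. borel))"
      unfolding Z_def by measurable
    have meas: "(\<lambda>z. ennreal c * disc_hit a H (\<lambda>k. S k z) m) \<in> borel_measurable (PiM {..<m} (\<lambda>_. borel))"
    proof -
      have [measurable]: "(\<lambda>z. disc_hit a H (\<lambda>k. S k z) m) \<in> borel_measurable (PiM {..<m} (\<lambda>_. borel))"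
        by (intro measurable_disc_hit[OF H]) (auto simp: S_def intro!: measurable_partial_sum)
      show ?thesis
        by measurable
    qed
    \<comment> \<open>X 0 vanishes only almost surely, so the telescoped increments recover the path
      only almost everywhere.\<close>
    have "AE \<omega> in M. ennreal c * J m \<omega> = ennreal c * disc_hit a H (\<lambda>k. S k (Z \<omega>)) m"
      using start
    proof eventually_elim
      case (elim \<omega>)
      have "S k (Z \<omega>) = x + X (real k * \<delta>) \<omega>" if "k \<le> m" for k
      proof -
        have "(\<Sum>i<k. Z \<omega> i) = (\<Sum>i<k. X (real (Suc i) * \<delta>) \<omega> - X (real i * \<delta>) \<omega>)"
          unfolding Z_def using that by (intro sum.cong) auto
        also have "\<dots> = X (real k * \<delta>) \<omega> - X (real 0 * \<delta>) \<omega>"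
          by (rule sum_lessThan_telescope)
        finally show ?thesis
          using elim by (simp add: S_def)
      qed
      then show ?case
        unfolding J_def by (intro arg_cong2[where f = "(*)"] refl disc_hit_cong) simp
    qed
    then have "(\<integral>\<^sup>+ \<omega>. ennreal c * J m \<omega> \<partial>M) = (\<integral>\<^sup>+ \<omega>. ennreal c * disc_hit a H (\<lambda>k. S k (Z \<omega>)) m \<partial>M)"
      by (rule nn_integral_cong_AE)
    also have "\<dots> = (\<integral>\<^sup>+ z. ennreal c * disc_hit a H (\<lambda>k. S k z) m \<partial>distr M (PiM {..<m} (\<lambda>_. borel)) Z)"
      by (rule nn_integral_distr[OF Z_meas, symmetric]) (use meas in simp)
    also have "distr M (PiM {..<m} (\<lambda>_. borel)) Z = PiM {..<m} (\<lambda>_. distr M borel (X \<delta>))"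
      unfolding Z_def by (rule distr_skeleton_increments[OF \<delta> m])
    also have "(\<integral>\<^sup>+ z. ennreal c * disc_hit a H (\<lambda>k. S k z) m \<partial>\<dots>) \<le> ennreal (w x)"
      unfolding S_def
    proof (rule random_walk_maximal_inequality[OF _ _ a H w w0])
      have [measurable]: "X \<delta> \<in> borel_measurable M"
        using \<delta> by (intro measurable_X) simp
      show "prob_space (distr M borel (X \<delta>))"
        by (intro prob_space_distr) measurable
      show "(\<integral>\<^sup>+ z. ennreal (w (y + z)) \<partial>distr M borel (X \<delta>)) \<le> ennreal (w y / a)" for y
        using step[of y] by (subst nn_integral_distr) (auto simp: a_def exp_minus field_simps)
    qed (use c in auto)
    finally show ?thesis .
  qed
  have inc: "incseq J"
    unfolding J_def disc_hit_def by (intro incseq_SucI le_funI SUP_subset_mono) auto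
  have sup: "(SUP k. ennreal (exp (- \<eta> * (real k * \<delta>))) * indicator H (x + X (real k * \<delta>) \<omega>)) = (SUP m. J m \<omega>)" for \<omega>
  proof (rule antisym)
    show "(SUP k. ennreal (exp (- \<eta> * (real k * \<delta>))) * indicator H (x + X (real k * \<delta>) \<omega>)) \<le> (SUP m. J m \<omega>)"
    proof (rule SUP_mono)
      fix k
      show "\<exists>m\<in>UNIV. ennreal (exp (- \<eta> * (real k * \<delta>))) * indicator H (x + X (real k * \<delta>) \<omega>) \<le> J m \<omega>"
        unfolding J_def disc_hit_def ak by (intro bexI[of _ k] SUP_upper2[of k]) auto
    qed
    show "(SUP m. J m \<omega>) \<le> (SUP k. ennreal (exp (- \<eta> * (real k * \<delta>))) * indicator H (x + X (real k * \<delta>) \<omega>))"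
      unfolding J_def disc_hit_def ak by (intro SUP_least SUP_upper) auto
  qed
  have "(\<integral>\<^sup>+ \<omega>. J m \<omega> \<partial>M) \<le> ennreal (w x / c)" for m
  proof -
    \<comment> \<open>\<open>J_le\<close> is for positive horizons, so the bound at m is obtained
      from that at Suc m.\<close>
    have "ennreal c * (\<integral>\<^sup>+ \<omega>. J (Suc m) \<omega> \<partial>M) \<le> ennreal (w x)"
      using J_le[of "Suc m"] by (subst nn_integral_cmult[symmetric]) auto
    also have "\<dots> = ennreal c * ennreal (w x / c)"
      using c w0 by (simp flip: ennreal_mult)
    finally have "(\<integral>\<^sup>+ \<omega>. J (Suc m) \<omega> \<partial>M) \<le> ennreal (w x / c)"
      using c by (simp add: ennreal_mult_le_mult_iff)
    moreover have "(\<integral>\<^sup>+ \<omega>. J m \<omega> \<partial>M) \<le> (\<integral>\<^sup>+ \<omega>. J (Suc m) \<omega> \<partial>M)"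
      using inc by (intro nn_integral_mono) (auto simp: incseq_Suc_iff le_fun_def)
    ultimately show ?thesis
      by simp
  qed
  then show ?thesis
    unfolding sup using inc by (subst nn_integral_monotone_convergence_SUP) (auto intro: SUP_least)
qed

text \<open>Leaving the complement means hitting the closed ball. By right continuity a path that is
  in the closed ball of radius \<rho> stays in the larger open ball for a short while, during which
  every fine enough skeleton has a point.\<close>

lemma exit_time_complement_cball_le:
  assumes \<eta>: "0 < \<eta>" and h0: "0 < h0" and \<rho>: "\<rho> < R"
    and cont: "\<forall>t\<ge>0. ((\<lambda>s. X s \<omega>) \<longlongrightarrow> X t \<omega>) (at_right t)"
    and fin: "exit_time X x (- cball 0 \<rho>) \<omega> < \<infinity>"
  shows "ennreal (exp (- \<eta> * enn2real (exit_time X x (- cball 0 \<rho>) \<omega>)))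
    \<le> liminf (\<lambda>n. SUP k. ennreal (exp (- \<eta> * (real k * (h0 / real (Suc n))))) *
        indicator (ball 0 R) (x + X (real k * (h0 / real (Suc n))) \<omega>))"
    (is "_ \<le> liminf ?v")
proof -
  define \<tau> where "\<tau> = enn2real (exit_time X x (- cball 0 \<rho>) \<omega>)"
  have \<tau>: "exit_time X x (- cball 0 \<rho>) \<omega> = ennreal \<tau>" "0 \<le> \<tau>"
    using fin by (simp_all add: \<tau>_def)
  \<comment> \<open>The slack \<epsilon> leaves room both for a hitting time close to the infimum
    and for the next grid point.\<close>
  have le: "ennreal (exp (- \<eta> * (\<tau> + \<epsilon>))) \<le> liminf ?v" if \<epsilon>: "0 < \<epsilon>" for \<epsilon>
  proof -
    have "exit_time X x (- cball 0 \<rho>) \<omega> < ennreal (\<tau> + \<epsilon>)"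
      unfolding \<tau>(1) using \<tau>(2) \<epsilon> by (simp add: ennreal_less_iff)
    then obtain t where t: "0 \<le> t" "x + X t \<omega> \<in> cball 0 \<rho>" "t < \<tau> + \<epsilon>"
      unfolding exit_time_def Inf_less_iff by (auto simp: ennreal_less_iff)
    have "((\<lambda>s. x + X s \<omega>) \<longlongrightarrow> x + X t \<omega>) (at_right t)"
      using cont t(1) by (intro tendsto_intros) auto
    moreover have "x + X t \<omega> \<in> ball 0 R"
      using t(2) \<rho> by simp
    ultimately have "\<forall>\<^sub>F s in at_right t. x + X s \<omega> \<in> ball 0 R"
      by (intro topological_tendstoD) auto
    then obtain b where b: "t < b" "\<And>s. t < s \<Longrightarrow> s < b \<Longrightarrow> x + X s \<omega> \<in> ball 0 R"
      by (auto simp: eventually_at_right_field)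
    define d where "d = min b (\<tau> + \<epsilon>) - t"
    have d: "0 < d"
      using b(1) t(3) by (simp add: d_def)
    have "(\<lambda>n. h0 / real (Suc n)) \<longlonglongrightarrow> 0"
      using LIMSEQ_Suc[OF lim_const_over_n[of h0]] .
    then have "\<forall>\<^sub>F n in sequentially. h0 / real (Suc n) < d"
      using d by (intro order_tendstoD(2)) auto
    then have "\<forall>\<^sub>F n in sequentially. ennreal (exp (- \<eta> * (\<tau> + \<epsilon>))) \<le> ?v n"
    proof eventually_elim
      case (elim n)
      define \<delta> where "\<delta> = h0 / real (Suc n)"
      have \<delta>: "0 < \<delta>" "\<delta> < d"
        using h0 elim by (auto simp: \<delta>_def)
      \<comment> \<open>The first grid point strictly after t: right continuity gives control at
        times beyond t.\<close>
      define k where "k = Suc (nat \<lfloor>t / \<delta>\<rfloor>)"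
      have "real k = real_of_int \<lfloor>t / \<delta>\<rfloor> + 1"
        using t(1) \<delta> by (simp add: k_def)
      then have "t / \<delta> < real k" "real k \<le> t / \<delta> + 1"
        by linarith+
      then have "t < real k * \<delta>" "real k * \<delta> \<le> t + \<delta>"
        using \<delta> by (simp_all add: field_simps)
      then have k: "t < real k * \<delta>" "real k * \<delta> < b" "real k * \<delta> \<le> \<tau> + \<epsilon>"
        using \<delta> by (auto simp: d_def)
      have "ennreal (exp (- \<eta> * (\<tau> + \<epsilon>))) \<le> ennreal (exp (- \<eta> * (real k * \<delta>)))"
        using k(3) \<eta> by (intro ennreal_leI) simp
      also have "\<dots> = ennreal (exp (- \<eta> * (real k * \<delta>))) * indicator (ball 0 R) (x + X (real k * \<delta>) \<omega>)"
        using b(2)[OF k(1,2)] by simp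
      also have "\<dots> \<le> ?v n"
        unfolding \<delta>_def by (intro SUP_upper) simp
      finally show ?case .
    qed
    then show ?thesis
      by (rule Liminf_bounded)
  qed
  have lim: "(\<lambda>n. ennreal (exp (- \<eta> * (\<tau> + 1 / real (Suc n))))) \<longlonglongrightarrow> ennreal (exp (- \<eta> * (\<tau> + 0)))"
    using LIMSEQ_Suc[OF lim_const_over_n[of 1]]
    by (intro tendsto_ennrealI tendsto_exp tendsto_mult tendsto_add tendsto_const) simp
  have "ennreal (exp (- \<eta> * (\<tau> + 0))) \<le> liminf ?v"
    by (rule LIMSEQ_le_const2[OF lim]) (intro exI allI impI le, simp)
  then show ?thesis
    unfolding \<tau>_def[symmetric] by (simp only: add_0_right)
qed

text \<open>No measurability of the exit time or of \<open>\<Phi>\<close> is available: the integrand is dominated by the lower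
  limit of discounted hitting indicators along time skeletons of vanishing mesh.\<close>

lemma nn_integral_exit_time_le:
  fixes w :: "real ^ 'n \<Rightarrow> real" and \<Phi> :: "'w \<Rightarrow> ennreal"
  assumes \<eta>: "0 < \<eta>" and h0: "0 < h0" and \<rho>: "\<rho> < R"
    and w: "w \<in> borel_measurable borel" and w0: "\<And>y. 0 \<le> w y"
    and c: "0 < c" "\<And>y. norm y < R \<Longrightarrow> c \<le> w y"
    and step: "\<And>h y. 0 < h \<Longrightarrow> h \<le> h0 \<Longrightarrow> (\<integral>\<^sup>+ \<omega>. ennreal (w (y + X h \<omega>)) \<partial>M) \<le> ennreal (exp (\<eta> * h) * w y)"
    and \<Phi>: "\<And>\<omega>. exit_time X x (- cball 0 \<rho>) \<omega> < \<infinity> \<Longrightarrow>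
        \<Phi> \<omega> \<le> F * ennreal (exp (- \<eta> * enn2real (exit_time X x (- cball 0 \<rho>) \<omega>)))"
      "\<And>\<omega>. exit_time X x (- cball 0 \<rho>) \<omega> = \<infinity> \<Longrightarrow> \<Phi> \<omega> = 0"
  shows "(\<integral>\<^sup>+ \<omega>. \<Phi> \<omega> \<partial>M) \<le> F * ennreal (w x / c)"
proof -
  define d where "d n = h0 / real (Suc n)" for n
  have d: "0 < d n" "d n \<le> h0" for n
    using h0 by (simp_all add: d_def field_simps)
  define v where "v n \<omega> = (SUP k. ennreal (exp (- \<eta> * (real k * d n))) *
        indicator (ball 0 R) (x + X (real k * d n) \<omega>) :: ennreal)" for n \<omega>
  have [measurable]: "X (real k * d n) \<in> borel_measurable M" for k n
    using d(1)[of n] by (intro measurable_X) simp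
  have [measurable]: "ball (0 :: real ^ 'n) R \<in> sets borel"
    by simp
  have [measurable]: "v n \<in> borel_measurable M" for n
    unfolding v_def by measurable
  have v_le: "(\<integral>\<^sup>+ \<omega>. v n \<omega> \<partial>M) \<le> ennreal (w x / c)" for n
    unfolding v_def
    using d c(2) by (intro skeleton_maximal_inequality \<eta> w w0 c(1) step) auto
  have "AE \<omega> in M. \<Phi> \<omega> \<le> F * liminf (\<lambda>n. v n \<omega>)"
    using cadlag
  proof eventually_elim
    case (elim \<omega>)
    show ?case
    proof (cases "exit_time X x (- cball 0 \<rho>) \<omega> < \<infinity>")
      case True
      have "F * ennreal (exp (- \<eta> * enn2real (exit_time X x (- cball 0 \<rho>) \<omega>))) \<le> F * liminf (\<lambda>n. v n \<omega>)"
        unfolding v_def d_def using elim True by (intro mult_left_mono exit_time_complement_cball_le \<eta> h0 \<rho>) auto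
      then show ?thesis
        using \<Phi>(1)[OF True] by simp
    next
      case False
      then show ?thesis
        using \<Phi>(2)[of \<omega>] by (simp flip: less_top)
    qed
  qed
  then have "(\<integral>\<^sup>+ \<omega>. \<Phi> \<omega> \<partial>M) \<le> (\<integral>\<^sup>+ \<omega>. F * liminf (\<lambda>n. v n \<omega>) \<partial>M)"
    by (rule nn_integral_mono_AE)
  also have "\<dots> = F * (\<integral>\<^sup>+ \<omega>. liminf (\<lambda>n. v n \<omega>) \<partial>M)"
    by (intro nn_integral_cmult) measurable
  \<comment> \<open>Fatou's lemma, along meshes tending to 0.\<close>
  also have "\<dots> \<le> F * liminf (\<lambda>n. \<integral>\<^sup>+ \<omega>. v n \<omega> \<partial>M)"
    by (intro mult_left_mono nn_integral_liminf) auto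
  also have "\<dots> \<le> F * liminf (\<lambda>n. ennreal (w x / c))"
    using v_le by (intro mult_left_mono Liminf_mono) auto
  finally show ?thesis
    by (simp add: Liminf_const)
qed

end

section \<open>Decay of bounded harmonic functions by comparison with the mixture\<close>

theorem theorem3p2:
  fixes M :: "'w measure" and X :: "real \<Rightarrow> 'w \<Rightarrow> real ^ 'n"
    and A :: "real ^ 'n ^ 'n" and \<nu> :: "real ^ 'n \<Rightarrow> real" and p :: "real \<Rightarrow> real ^ 'n \<Rightarrow> ennreal"
  assumes "jump_paring_levy_process M X A \<nu> p"
    and "\<exists>C15>0. \<forall>r\<ge>1. \<forall>x y. norm y \<le> r \<and> 2 * r \<le> norm x \<longrightarrow> \<nu> (x - y) \<le> C15 * \<nu> x"
    and "(SUP s\<in>{1..}. K3 M X p s * ennreal (sup_levy_exponent A \<nu> (1 / s) * s ^ CARD('n))) < \<infinity>"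
  shows "\<forall>\<eta>>0. \<forall>r>0. \<exists>C16>0. \<exists>R>0. \<forall>f.
           harmonic_in M X \<eta> (- cball 0 r) f \<and> bounded (range f) \<longrightarrow>
           (\<forall>x. R \<le> norm x \<longrightarrow> f x \<le> C16 * (SUP y. \<bar>f y\<bar>) * \<nu> x)"
proof (intro allI impI)
  interpret jump_paring_levy_process M X A \<nu> p
    by (rule assms)
  obtain g c where g_pos: "\<And>u. 0 < u \<Longrightarrow> 0 < g u" and anti: "antimono_on {0<..} g" and c: "1 \<le> c"
    and \<nu>g: "\<And>x. x \<noteq> 0 \<Longrightarrow> inverse c * g (norm x) \<le> \<nu> x \<and> \<nu> x \<le> c * g (norm x)"
    using jump_paring by blast
  obtain D where D: "0 < D" "\<And>r x y. 1 \<le> r \<Longrightarrow> norm y \<le> r \<Longrightarrow> 2 * r \<le> norm x \<Longrightarrow> \<nu> (x - y) \<le> D * \<nu> x"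
    using assms(2) by blast
  have g_le: "g (norm x) \<le> c * \<nu> x" if "x \<noteq> 0" for x :: "real ^ 'n"
    using \<nu>g[OF that] c by (simp add: field_simps)
  have doubling: "g s \<le> c * D * c * g (2 * s)" if s: "1 \<le> s" for s
  proof -
    \<comment> \<open>Doubling comes from the first hypothesis with r = s, x = 2 s e and y = s e,
      for a unit vector e.\<close>
    define e where "e = axis (undefined :: 'n) (1 :: real)"
    have e: "norm e = 1"
      by (simp add: e_def)
    have ne: "s *\<^sub>R e \<noteq> 0" "(2 * s) *\<^sub>R e \<noteq> 0"
      using s e by auto
    have "g s \<le> c * \<nu> (s *\<^sub>R e)"
      using g_le[OF ne(1)] s e by simp
    also have "s *\<^sub>R e = (2 * s) *\<^sub>R e - s *\<^sub>R e"
      by (simp flip: scaleR_diff_left)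
    also have "\<nu> \<dots> \<le> D * \<nu> ((2 * s) *\<^sub>R e)"
      using s e by (intro D(2)[of s]) auto
    also have "\<dots> \<le> D * (c * g (2 * s))"
      using \<nu>g[OF ne(2)] D(1) s e by simp
    finally show ?thesis
      using c by (simp add: mult.assoc)
  qed
  interpret doubling_levy_process M X A \<nu> p g "c * D * c" c
    by unfold_locales (use g_pos anti c \<nu>g g_le doubling in \<open>auto simp: monotone_on_def\<close>)
  fix \<eta> r :: real
  assume \<eta>: "0 < \<eta>" and r: "0 < r"
  obtain C where "\<forall>R0. \<exists>R\<ge>R0. 1 \<le> R \<and>
     (\<forall>n. \<exists>h0>0. \<forall>h y. 0 < h \<and> h \<le> h0 \<longrightarrow>
        expectation (\<lambda>\<omega>. mixture R n (y + X h \<omega>)) \<le> exp (\<eta> * h) * mixture R n y) \<and>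
     (\<forall>n y. max (norm y) R \<le> dyadic R n \<longrightarrow> mixture R n (y :: real ^ 'n) \<le> C * g (max (norm y) R))"
    using exists_supersolution[OF \<eta>] by blast
  \<comment> \<open>The factor 3 places the ball of radius 2 r strictly inside the ball of radius R,
    as the skeleton argument requires.\<close>
  from this[rule_format, of "3 * r"]
  obtain R where R: "3 * r \<le> R" "1 \<le> R"
    and super: "\<And>n. \<exists>h0>0. \<forall>h y. 0 < h \<and> h \<le> h0 \<longrightarrow>
        expectation (\<lambda>\<omega>. mixture R n (y + X h \<omega>)) \<le> exp (\<eta> * h) * mixture R n y"
    and upper: "\<And>n y :: real ^ 'n. max (norm y) R \<le> dyadic R n \<Longrightarrow> mixture R n y \<le> C * g (max (norm y) R)"
    by blast
  have R0: "0 < R"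
    using R by simp
  have C: "0 < C"
  proof -
    have "0 < C * g R"
      using less_le_trans[OF mixture_pos[OF R0, of 0 "0 :: real ^ 'n"] upper[of 0 0]] R0 by (simp add: dyadic_0)
    then show ?thesis
      using g_pos[OF R0] by (simp add: zero_less_mult_iff)
  qed
  \<comment> \<open>A lower bound for the mixture on the ball of radius R that is uniform in the
    truncation level.\<close>
  define b where "b = exp (- 1 / 2) * g (2 * R)"
  have b: "0 < b"
    unfolding b_def using g_pos[of "2 * R"] R0 by simp
  define C16 where "C16 = C * c / b"
  show "\<exists>C16>0. \<exists>R>0. \<forall>f. harmonic_in M X \<eta> (- cball 0 r) f \<and> bounded (range f) \<longrightarrow>
           (\<forall>x. R \<le> norm x \<longrightarrow> f x \<le> C16 * (SUP y. \<bar>f y\<bar>) * \<nu> x)"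
  proof (rule exI[of _ C16], rule conjI[rotated], rule exI[of _ R], intro conjI allI impI)
    show "0 < C16" "0 < R"
      using C c b R0 by (auto simp: C16_def)
    fix f and x :: "real ^ 'n"
    assume f: "harmonic_in M X \<eta> (- cball 0 r) f \<and> bounded (range f)" and x: "R \<le> norm x"
    define F where "F = (SUP y. \<bar>f y\<bar>)"
    have "bdd_above (range (\<lambda>y. \<bar>f y\<bar>))"
      using f by (auto simp: bounded_iff bdd_above_def)
    then have F: "\<bar>f y\<bar> \<le> F" for y
      unfolding F_def by (rule cSUP_upper[OF UNIV_I])
    have F0: "0 \<le> F"
      using F[of 0] by simp
    \<comment> \<open>The truncation level follows x, because the upper bound for the mixture holds
      only up to \<open>dyadic R n\<close>; C16 and R do not depend on it.\<close>
    obtain n where n: "norm x \<le> dyadic R n"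
      using dyadic_unbounded[OF R0] by blast
    obtain h0 where h0: "0 < h0" "\<And>h y. 0 < h \<Longrightarrow> h \<le> h0 \<Longrightarrow>
        expectation (\<lambda>\<omega>. mixture R n (y + X h \<omega>)) \<le> exp (\<eta> * h) * mixture R n y"
      using super[of n] by blast
    have w_meas [measurable]: "(mixture R n :: real ^ 'n \<Rightarrow> real) \<in> borel_measurable borel"
      unfolding mixture_def[abs_def] by measurable
    have "ennreal (f x) \<le> ennreal F * ennreal (mixture R n x / b)"
    proof -
      \<comment> \<open>Doubling the radius puts the closure of the set strictly inside the domain
        of harmonicity.\<close>
      have U: "open (- cball 0 (2 * r) :: (real ^ 'n) set)" "x \<in> - cball 0 (2 * r)"
        using R x r by auto
      have "closure (- cball 0 (2 * r) :: (real ^ 'n) set) \<subseteq> - cball 0 r"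
        unfolding closure_complement interior_cball using r by auto
      with U have "ennreal (f x) = (\<integral>\<^sup>+ \<omega>. (if exit_time X x (- cball 0 (2 * r)) \<omega> < \<infinity>
          then ennreal (exp (- \<eta> * enn2real (exit_time X x (- cball 0 (2 * r)) \<omega>))
            * f (exit_position X x (- cball 0 (2 * r)) \<omega>)) else 0) \<partial>M)"
        using f unfolding harmonic_in_def by blast
      also have "\<dots> \<le> ennreal F * ennreal (mixture R n x / b)"
      proof (rule nn_integral_exit_time_le[OF \<eta> h0(1) _ w_meas])
        show "2 * r < R"
          using R r by simp
        show "0 \<le> mixture R n y" for y :: "real ^ 'n"
          using mixture_pos[OF R0, of n y] by simp
        show "b \<le> mixture R n y" if "norm y < R" for y :: "real ^ 'n"
          using mixture_lower[OF R0, of y n] that by (simp add: b_def max_def split: if_splits)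
        show "(\<integral>\<^sup>+ \<omega>. ennreal (mixture R n (y + X h \<omega>)) \<partial>M) \<le> ennreal (exp (\<eta> * h) * mixture R n y)"
          if h: "0 < h" "h \<le> h0" for h y
        proof -
          have [measurable]: "X h \<in> borel_measurable M"
            using h by (intro measurable_X) simp
          have int: "integrable M (\<lambda>\<omega>. mixture R n (y + X h \<omega>))"
            unfolding mixture_def
            by (intro Bochner_Integration.integrable_add Bochner_Integration.integrable_sum integrable_mult_right
                integrable_const integrable_const_bound[where B = 1]) (auto simp: gauss_le_1 gauss_pos less_imp_le)
          show ?thesis
            using mixture_pos[OF R0, of n] less_imp_le
            by (subst nn_integral_eq_integral[OF int]) (auto intro!: ennreal_leI h0(2) h)
        qed
        fix \<omega>
        show "(if exit_time X x (- cball 0 (2 * r)) \<omega> < \<infinity>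
          then ennreal (exp (- \<eta> * enn2real (exit_time X x (- cball 0 (2 * r)) \<omega>))
            * f (exit_position X x (- cball 0 (2 * r)) \<omega>)) else 0)
          \<le> ennreal F * ennreal (exp (- \<eta> * enn2real (exit_time X x (- cball 0 (2 * r)) \<omega>)))"
          using F[of "exit_position X x (- cball 0 (2 * r)) \<omega>"] F0
          by (auto simp flip: ennreal_mult intro!: ennreal_leI)
      qed (use b in auto)
      finally show ?thesis .
    qed
    then have "f x \<le> F * (mixture R n x / b)"
      using F0 b mixture_pos[OF R0, of n x] by (simp flip: ennreal_mult add: ennreal_le_iff)
    also have "\<dots> \<le> F * (C * (c * \<nu> x) / b)"
    proof (intro mult_left_mono divide_right_mono F0)
      have "mixture R n x \<le> C * g (norm x)"
        using upper[of x n] x n by (simp add: max_absorb1)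
      also have "\<dots> \<le> C * (c * \<nu> x)"
        using C x R0 by (intro mult_left_mono g_le) auto
      finally show "mixture R n x \<le> C * (c * \<nu> x)" .
    qed (use b in simp)
    finally show "f x \<le> C16 * (SUP y. \<bar>f y\<bar>) * \<nu> x"
      by (simp add: C16_def F_def mult_ac)
  qed
qed

end
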